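(* Let $p$ be a prime, let $G$ be a finite group of $p$-power order, and let $\varphi\colon A\to B$ be an isomorphism between subgroups $A,B$ of $G$. Let $G^*=\langle G,t \mid t^{-1}at=\varphi(a),\ a\in A\rangle$ be the HNN extension. Suppose there exists a central filtration $(G_1,\dots,G_n)$ of $G$, compatible with $(G,\varphi)$, such that for every $i$ the order of the automorphism of the core $H(G_i/G_{i+1},\varphi_{i,i+1})$ induced by $\varphi_{i,i+1}$ is a power of $p$. Then $G^*$ is residually $p$, i.e. for every non-trivial $g\in G^*$ there is a homomorphism from $G^*$ to a finite $p$-group whose value at $g$ is non-trivial.
   Context: An HNN pair $(G,\varphi)$ consists of a group $G$ and an isomorphism $\varphi\colon A\to B$ between subgroups of $G$. A filtration of $G$ is a sequence $(G_1,\dots,G_n)$ of normal subgroups of $G$ with $G=G_1\supsetneq G_2\supsetneq\cdots\supsetneq G_n=\{1\}$; one sets $G_i=\{1\}$ for $i>n$. It is central if $G_i/G_{i+1}$ is central in $G/G_{i+1}$ for each $i$. The filtration is compatible with $(G,\varphi)$ if $\varphi$ restricts to an isomorphism $A\cap G_i\to B\cap G_i$ for each $i$. In that case, for $i<j$, $\varphi$ induces an isomorphism $\varphi_{ij}\colon (A\cap G_i)G_j/G_j\to (B\cap G_i)G_j/G_j$ between subgroups of $G_i/G_j$, so $(G_i/G_j,\varphi_{ij})$ is again an HNN pair. For an HNN pair $(Q,\psi\colon A'\to B')$, its core $H(Q,\psi)$ is defined by $H_0=A'\cap B'$, $H_{k+1}=\psi^{-1}(H_k)\cap H_k\cap\psi(H_k)$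 (where $\psi^{-1}(H_k)=\{a\in A':\psi(a)\in H_k\}$), and $H(Q,\psi)=\bigcap_k H_k$; $\psi$ restricts to an automorphism of $H(Q,\psi)$. *)

theory Defs
  imports "HOL-Algebra.Algebra"
begin

text \<open>Words in the letters of G together with t (Inr True) and t^-1 (Inr False).\<close>
type_synonym 'a hnn_word = "('a + bool) list"

definition hnn_valid :: "('a, 'b) monoid_scheme \<Rightarrow> 'a hnn_word \<Rightarrow> bool" where
  "hnn_valid G w \<longleftrightarrow> (\<forall>l\<in>set w. case l of Inl g \<Rightarrow> g \<in> carrier G | Inr _ \<Rightarrow> True)"

inductive hnn_eq :: "('a, 'b) monoid_scheme \<Rightarrow> 'a set \<Rightarrow> ('a \<Rightarrow> 'a) \<Rightarrow> 'a hnn_word \<Rightarrow> 'a hnn_word \<Rightarrow> bool"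
  for G A \<phi> where
  refl: "hnn_valid G w \<Longrightarrow> hnn_eq G A \<phi> w w"
| sym: "hnn_eq G A \<phi> u v \<Longrightarrow> hnn_eq G A \<phi> v u"
| trans: "hnn_eq G A \<phi> u v \<Longrightarrow> hnn_eq G A \<phi> v w \<Longrightarrow> hnn_eq G A \<phi> u w"
| cong: "hnn_eq G A \<phi> u v \<Longrightarrow> hnn_valid G x \<Longrightarrow> hnn_valid G y \<Longrightarrow>
         hnn_eq G A \<phi> (x @ u @ y) (x @ v @ y)"
| mult: "g \<in> carrier G \<Longrightarrow> h \<in> carrier G \<Longrightarrow> hnn_eq G A \<phi> [Inl g, Inl h] [Inl (g \<otimes>\<^bsub>G\<^esub> h)]"
| one: "hnn_eq G A \<phi> [Inl \<one>\<^bsub>G\<^esub>] []"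
| t_tinv: "hnn_eq G A \<phi> [Inr True, Inr False] []"
| tinv_t: "hnn_eq G A \<phi> [Inr False, Inr True] []"
| conj: "a \<in> A \<Longrightarrow> hnn_eq G A \<phi> [Inr False, Inl a, Inr True] [Inl (\<phi> a)]"

definition hnn_class :: "('a, 'b) monoid_scheme \<Rightarrow> 'a set \<Rightarrow> ('a \<Rightarrow> 'a) \<Rightarrow> 'a hnn_word \<Rightarrow> 'a hnn_word set" where
  "hnn_class G A \<phi> w = {v. hnn_eq G A \<phi> w v}"

definition HNN :: "('a, 'b) monoid_scheme \<Rightarrow> 'a set \<Rightarrow> ('a \<Rightarrow> 'a) \<Rightarrow> ('a hnn_word set) monoid" where
  "HNN G A \<phi> = \<lparr> carrier = hnn_class G A \<phi> ` {w. hnn_valid G w},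
     monoid.mult = (\<lambda>U V. {w. \<exists>x y. x \<in> U \<and> y \<in> V \<and> hnn_eq G A \<phi> (x @ y) w}),
     monoid.one = hnn_class G A \<phi> [] \<rparr>"

definition filtration :: "('a, 'b) monoid_scheme \<Rightarrow> nat \<Rightarrow> (nat \<Rightarrow> 'a set) \<Rightarrow> bool" where
  "filtration G n Gs \<longleftrightarrow> 1 \<le> n \<and> Gs 1 = carrier G \<and> Gs n = {\<one>\<^bsub>G\<^esub>}
     \<and> (\<forall>i\<in>{1..n}. Gs i \<lhd> G)
     \<and> (\<forall>i\<in>{1..<n}. Gs (Suc i) \<subset> Gs i)
     \<and> (\<forall>i>n. Gs i = {\<one>\<^bsub>G\<^esub>})"

text \<open>G_i/G_(i+1) central in G/G_(i+1): commutators [x,y] with x in G_i, y in G lie in G_(i+1).\<close>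
definition central_filtration :: "('a, 'b) monoid_scheme \<Rightarrow> nat \<Rightarrow> (nat \<Rightarrow> 'a set) \<Rightarrow> bool" where
  "central_filtration G n Gs \<longleftrightarrow> filtration G n Gs \<and>
     (\<forall>i\<in>{1..n}. \<forall>x\<in>Gs i. \<forall>y\<in>carrier G.
        x \<otimes>\<^bsub>G\<^esub> y \<otimes>\<^bsub>G\<^esub> inv\<^bsub>G\<^esub> x \<otimes>\<^bsub>G\<^esub> inv\<^bsub>G\<^esub> y \<in> Gs (Suc i))"

definition compatible :: "('a, 'b) monoid_scheme \<Rightarrow> 'a set \<Rightarrow> 'a set \<Rightarrow> ('a \<Rightarrow> 'a) \<Rightarrow> nat \<Rightarrow> (nat \<Rightarrow> 'a set) \<Rightarrow> bool" where
  "compatible G A B \<phi> n Gs \<longleftrightarrow> (\<forall>i\<in>{1..n}. \<phi> ` (A \<inter> Gs i) = B \<inter> Gs i)"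

text \<open>Elements of G_i/G_j are the cosets G_j #> g (g in G_i), as in (G restricted to G_i) Mod G_j.\<close>
definition quot_dom :: "('a, 'b) monoid_scheme \<Rightarrow> 'a set \<Rightarrow> 'a set \<Rightarrow> 'a set \<Rightarrow> 'a set set" where
  "quot_dom G A Gi Gj = {Gj #>\<^bsub>G\<^esub> a | a. a \<in> A \<inter> Gi}"

definition quot_map :: "('a, 'b) monoid_scheme \<Rightarrow> 'a set \<Rightarrow> ('a \<Rightarrow> 'a) \<Rightarrow> 'a set \<Rightarrow> 'a set \<Rightarrow> 'a set \<Rightarrow> 'a set" where
  "quot_map G A \<phi> Gi Gj C = Gj #>\<^bsub>G\<^esub> \<phi> (SOME a. a \<in> C \<inter> A \<inter> Gi)"

fun core_seq :: "'c set \<Rightarrow> 'c set \<Rightarrow> ('c \<Rightarrow> 'c) \<Rightarrow> nat \<Rightarrow> 'c set" where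
  "core_seq A' B' \<psi> 0 = A' \<inter> B'"
| "core_seq A' B' \<psi> (Suc k) =
     {a \<in> A'. \<psi> a \<in> core_seq A' B' \<psi> k} \<inter> core_seq A' B' \<psi> k \<inter> \<psi> ` core_seq A' B' \<psi> k"

definition core :: "'c set \<Rightarrow> 'c set \<Rightarrow> ('c \<Rightarrow> 'c) \<Rightarrow> 'c set" where
  "core A' B' \<psi> = (\<Inter>k. core_seq A' B' \<psi> k)"

definition perm_order :: "'c set \<Rightarrow> ('c \<Rightarrow> 'c) \<Rightarrow> nat" where
  "perm_order S \<psi> = (LEAST m. 0 < m \<and> (\<forall>x\<in>S. (\<psi> ^^ m) x = x))"

definition residually_p :: "nat \<Rightarrow> ('c, 'd) monoid_scheme \<Rightarrow> bool" where
  "residually_p p \<Gamma> \<longleftrightarrow> (\<forall>g\<in>carrier \<Gamma>. g \<noteq> \<one>\<^bsub>\<Gamma>\<^esub> \<longrightarrow>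
     (\<exists>(P :: nat monoid) h. group P \<and> finite (carrier P) \<and> (\<exists>k. card (carrier P) = p ^ k)
        \<and> h \<in> hom \<Gamma> P \<and> h g \<noteq> \<one>\<^bsub>P\<^esub>))"

end

theory Submission
  imports Defs
begin

text \<open>
  A homomorphism from the HNN extension to a \<open>p\<close>-group \<open>P\<close> is a homomorphism \<open>f\<close> on \<open>G\<close> together with
  \<open>\<tau> \<in> P\<close> satisfying \<open>f a \<tau> = \<tau> f (\<phi> a)\<close> for \<open>a \<in> A\<close>.

  Such pairs with \<open>ker f = G\<^sub>i\<close> are constructed by induction on \<open>i\<close>. The layer \<open>Z = G\<^sub>i/G\<^sub>i\<^sub>+\<^sub>1\<close> is glued
  cyclically along \<open>\<phi>\<close>: for a large power \<open>N\<close> of \<open>p\<close> the domain of the \<open>N\<close>-th power of the induced partial map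
  is its core, on which this power is the identity; therefore each copy of \<open>Z\<close> embeds into the quotient \<open>W\<close> of
  \<open>Z\<^sup>N\<close> that identifies \<open>a\<close> in position \<open>m\<close> with \<open>\<phi> a\<close> in position \<open>m - 1\<close>. As \<open>Z\<close> is central, the action on
  \<open>P \<times> \<int>/N\<close> lifts to a \<open>W\<close>-bundle over it, that is, to the wreath product of \<open>W\<close> with \<open>P \<times> \<int>/N\<close>.

  Once \<open>f\<close> is injective, passing repeatedly to the wreath product of \<open>\<int>/p\<close> with \<open>P\<close> raises the length of the
  shortest reduced word that becomes trivial, as for iterated mod \<open>p\<close> homology covers of a graph. Since every
  word can be brought into reduced form, this separates all elements from \<open>1\<close>; Britton's lemma is not needed.
\<close>

section \<open>Wreath products and realizations in p-groups\<close>

definition finite_p_group :: "nat \<Rightarrow> ('p, 'q) monoid_scheme \<Rightarrow> bool" where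
  "finite_p_group p P \<longleftrightarrow> group P \<and> finite (carrier P) \<and> (\<exists>k. card (carrier P) = p ^ k)"

text \<open>The regular wreath product, with \<open>P\<close> acting on functions by left
  translation. The element \<open>(u, x)\<close> acts on the trivial bundle by sending
  \<open>(w, z)\<close> to \<open>(u (x z) w, x z)\<close>. Extensional functions make agreement on
  \<open>carrier P\<close> the same as equality.\<close>

definition wreath :: "('w, 'r) monoid_scheme \<Rightarrow> ('p, 's) monoid_scheme \<Rightarrow> (('p \<Rightarrow> 'w) \<times> 'p) monoid" where
  "wreath W P = \<lparr> carrier = (carrier P \<rightarrow>\<^sub>E carrier W) \<times> carrier P,
     monoid.mult = (\<lambda>(u, x) (v, y).
       ((\<lambda>z\<in>carrier P. u z \<otimes>\<^bsub>W\<^esub> v (inv\<^bsub>P\<^esub> x \<otimes>\<^bsub>P\<^esub> z)), x \<otimes>\<^bsub>P\<^esub> y)),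
     monoid.one = ((\<lambda>z\<in>carrier P. \<one>\<^bsub>W\<^esub>), \<one>\<^bsub>P\<^esub>) \<rparr>"

lemma carrier_wreath: "carrier (wreath W P) = (carrier P \<rightarrow>\<^sub>E carrier W) \<times> carrier P"
  by (simp add: wreath_def)

lemma one_wreath: "\<one>\<^bsub>wreath W P\<^esub> = ((\<lambda>z\<in>carrier P. \<one>\<^bsub>W\<^esub>), \<one>\<^bsub>P\<^esub>)"
  by (simp add: wreath_def)

lemma mult_wreath: "(u, x) \<otimes>\<^bsub>wreath W P\<^esub> (v, y) =
    ((\<lambda>z\<in>carrier P. u z \<otimes>\<^bsub>W\<^esub> v (inv\<^bsub>P\<^esub> x \<otimes>\<^bsub>P\<^esub> z)), x \<otimes>\<^bsub>P\<^esub> y)"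
  by (simp add: wreath_def)

lemma group_wreath:
  assumes "group W" "group P"
  shows "group (wreath W P)"
proof -
  interpret W: group W by fact
  interpret P: group P by fact
  show ?thesis
  proof (rule groupI)
    fix a b assume "a \<in> carrier (wreath W P)" "b \<in> carrier (wreath W P)"
    then show "a \<otimes>\<^bsub>wreath W P\<^esub> b \<in> carrier (wreath W P)"
      by (auto simp: carrier_wreath mult_wreath PiE_iff split: prod.splits)
  next
    show "\<one>\<^bsub>wreath W P\<^esub> \<in> carrier (wreath W P)"
      by (simp add: carrier_wreath one_wreath)
  next
    fix a b c assume "a \<in> carrier (wreath W P)" "b \<in> carrier (wreath W P)" "c \<in> carrier (wreath W P)"
    moreover obtain u x v y w z where "a = (u, x)" "b = (v, y)" "c = (w, z)"
      by (metis surj_pair)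
    ultimately show "a \<otimes>\<^bsub>wreath W P\<^esub> b \<otimes>\<^bsub>wreath W P\<^esub> c
        = a \<otimes>\<^bsub>wreath W P\<^esub> (b \<otimes>\<^bsub>wreath W P\<^esub> c)"
      by (auto simp: carrier_wreath mult_wreath P.inv_mult_group P.m_assoc PiE_iff
          intro!: restrict_ext W.m_assoc)
  next
    fix a assume "a \<in> carrier (wreath W P)"
    then show "\<one>\<^bsub>wreath W P\<^esub> \<otimes>\<^bsub>wreath W P\<^esub> a = a"
      by (auto simp: carrier_wreath one_wreath mult_wreath PiE_iff extensional_def fun_eq_iff)
  next
    fix a assume "a \<in> carrier (wreath W P)"
    then obtain u x where a: "a = (u, x)" "u \<in> carrier P \<rightarrow>\<^sub>E carrier W" "x \<in> carrier P"
      by (auto simp: carrier_wreath)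
    let ?b = "((\<lambda>z\<in>carrier P. inv\<^bsub>W\<^esub> u (x \<otimes>\<^bsub>P\<^esub> z)), inv\<^bsub>P\<^esub> x)"
    have "?b \<in> carrier (wreath W P)"
      using a by (auto simp: carrier_wreath PiE_iff)
    moreover have "?b \<otimes>\<^bsub>wreath W P\<^esub> a = \<one>\<^bsub>wreath W P\<^esub>"
      using a by (auto simp: one_wreath mult_wreath PiE_iff intro!: restrict_ext W.l_inv)
    ultimately show "\<exists>b\<in>carrier (wreath W P). b \<otimes>\<^bsub>wreath W P\<^esub> a = \<one>\<^bsub>wreath W P\<^esub>"
      by blast
  qed
qed

lemma inv_wreath:
  assumes "group W" "group P" "u \<in> carrier P \<rightarrow>\<^sub>E carrier W" "x \<in> carrier P"
  shows "inv\<^bsub>wreath W P\<^esub> (u, x) = ((\<lambda>z\<in>carrier P. inv\<^bsub>W\<^esub> u (x \<otimes>\<^bsub>P\<^esub> z)), inv\<^bsub>P\<^esub> x)"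
proof -
  interpret W: group W by fact
  interpret P: group P by fact
  show ?thesis
    using assms(3,4)
    by (intro group.inv_equality[OF group_wreath[OF assms(1,2)]])
      (auto simp: carrier_wreath one_wreath mult_wreath PiE_iff intro!: restrict_ext W.l_inv)
qed

lemma finite_p_group_wreath:
  assumes "finite_p_group p W" "finite_p_group p P"
  shows "finite_p_group p (wreath W P)"
proof -
  obtain j k where "card (carrier W) = p ^ j" "card (carrier P) = p ^ k"
    using assms by (auto simp: finite_p_group_def)
  then have "card (carrier (wreath W P)) = p ^ (j * card (carrier P) + k)"
    using assms by (simp add: carrier_wreath card_cartesian_product card_PiE finite_p_group_def
        power_add power_mult)
  then show ?thesis
    using assms by (auto simp: finite_p_group_def group_wreath carrier_wreath intro!: finite_PiE)
qed

text \<open>A lift of \<open>f\<close> through the projection to \<open>P\<close> amounts to a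
  crossed homomorphism \<open>u\<close> into the functions on \<open>P\<close>, on which
  \<open>G\<close> acts through \<open>f\<close>.\<close>

lemma hom_wreathI:
  assumes "group W" "f \<in> hom G P"
    and "\<And>g y. g \<in> carrier G \<Longrightarrow> y \<in> carrier P \<Longrightarrow> u g y \<in> carrier W"
    and "\<And>g h y. g \<in> carrier G \<Longrightarrow> h \<in> carrier G \<Longrightarrow> y \<in> carrier P \<Longrightarrow>
      u (g \<otimes>\<^bsub>G\<^esub> h) y = u g y \<otimes>\<^bsub>W\<^esub> u h (inv\<^bsub>P\<^esub> f g \<otimes>\<^bsub>P\<^esub> y)"
    and "group P"
  shows "(\<lambda>g. (\<lambda>y\<in>carrier P. u g y, f g)) \<in> hom G (wreath W P)"
proof -
  interpret P: group P by fact
  show ?thesis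
    using assms(2-4)
    by (auto simp: hom_def Pi_iff carrier_wreath mult_wreath intro!: restrict_ext)
qed

lemma finite_group_iso_nat:
  assumes "group P" "finite (carrier P)"
  obtains P' :: "nat monoid" and h where "group P'" "h \<in> iso P P'"
proof -
  obtain h :: "_ \<Rightarrow> nat" where "inj_on h (carrier P)"
    using finite_imp_inj_to_nat_seg[OF assms(2)] by blast
  with assms(1) show thesis
    by (meson group.inj_imp_image_group_is_group inj_imp_image_group_iso that)
qed

definition hnn_realization ::
  "nat \<Rightarrow> ('a, 'b) monoid_scheme \<Rightarrow> 'a set \<Rightarrow> ('a \<Rightarrow> 'a) \<Rightarrow> ('p, 'q) monoid_scheme \<Rightarrow> ('a \<Rightarrow> 'p) \<Rightarrow> 'p \<Rightarrow> bool"
  where "hnn_realization p G A \<phi> P f \<tau> \<longleftrightarrow> finite_p_group p P \<and> f \<in> hom G P \<and> \<tau> \<in> carrier P \<and>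
    (\<forall>a\<in>A. f a \<otimes>\<^bsub>P\<^esub> \<tau> = \<tau> \<otimes>\<^bsub>P\<^esub> f (\<phi> a))"

lemma hnn_realization_iso:
  assumes "hnn_realization p G A \<phi> P f \<tau>" "h \<in> iso P P'" "group P'"
    and "A \<subseteq> carrier G" "\<phi> ` A \<subseteq> carrier G"
  shows "hnn_realization p G A \<phi> P' (h \<circ> f) (h \<tau>)"
proof -
  have h: "h \<in> hom P P'" "bij_betw h (carrier P) (carrier P')"
    using assms(2) by (auto simp: iso_def)
  have "f \<in> hom G P" "\<tau> \<in> carrier P" and rel: "\<And>a. a \<in> A \<Longrightarrow> f a \<otimes>\<^bsub>P\<^esub> \<tau> = \<tau> \<otimes>\<^bsub>P\<^esub> f (\<phi> a)"
    and fp: "finite_p_group p P"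
    using assms(1) by (auto simp: hnn_realization_def)
  have "h (f a) \<otimes>\<^bsub>P'\<^esub> h \<tau> = h \<tau> \<otimes>\<^bsub>P'\<^esub> h (f (\<phi> a))" if "a \<in> A" for a
  proof -
    have "f a \<in> carrier P" "f (\<phi> a) \<in> carrier P"
      using that assms(4,5) by (auto intro!: hom_in_carrier[OF \<open>f \<in> hom G P\<close>])
    then show ?thesis
      using rel[OF that] \<open>\<tau> \<in> carrier P\<close> by (simp flip: hom_mult[OF h(1)])
  qed
  moreover have "finite_p_group p P'"
    using fp assms(3) bij_betw_finite[OF h(2)] bij_betw_same_card[OF h(2)]
    by (simp add: finite_p_group_def)
  ultimately show ?thesis
    using h(1) \<open>f \<in> hom G P\<close> \<open>\<tau> \<in> carrier P\<close>
    by (auto simp: hnn_realization_def hom_in_carrier intro: hom_compose)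
qed

section \<open>Gluing an abelian layer along a partial isomorphism\<close>

text \<open>By pigeonhole two powers of \<open>\<psi>\<close> agree on the finite set
  \<open>S\<close>, and injectivity cancels the smaller one. So the \<open>LEAST\<close> in
  \<open>perm_order\<close> ranges over a non-empty set.\<close>

lemma perm_order_funpow:
  assumes "finite S" "\<psi> ` S \<subseteq> S" "inj_on \<psi> S"
  shows "0 < perm_order S \<psi> \<and> (\<forall>x\<in>S. (\<psi> ^^ perm_order S \<psi>) x = x)"
proof -
  have mem: "(\<psi> ^^ i) x \<in> S" if "x \<in> S" for i x
    using that assms(2) by (induction i) auto
  have inj: "inj_on (\<psi> ^^ i) S" for i
  proof (induction i)
    case (Suc i)
    then show ?case
      using assms(3) mem by (simp add: inj_on_def)
  qed auto
  \<comment> \<open>Restricting to \<open>S\<close> forgets the values elsewhere, so that the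
    \<open>F i\<close> lie in a finite function space.\<close>
  define F where "F i = restrict (\<psi> ^^ i) S" for i :: nat
  have "range F \<subseteq> S \<rightarrow>\<^sub>E S"
    using mem by (auto simp: F_def)
  then have "\<not> inj F"
    using assms(1) by (meson finite_PiE finite_subset infinite_UNIV_nat finite_imageD)
  then obtain i j where "i < j" and eq: "F i = F j"
    by (metis injI linorder_neqE_nat)
  have "(\<psi> ^^ (j - i)) x = x" if "x \<in> S" for x
  proof -
    have "(\<psi> ^^ i) ((\<psi> ^^ (j - i)) x) = (\<psi> ^^ i) x"
      using fun_cong[OF eq, of x] that \<open>i < j\<close> funpow_add[of i "j - i" \<psi>] by (simp add: F_def)
    then show ?thesis
      using inj[of i] mem that by (meson inj_onD)
  qed
  with \<open>i < j\<close> have "\<exists>m. 0 < m \<and> (\<forall>x\<in>S. (\<psi> ^^ m) x = x)"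
    by (meson zero_less_diff)
  then show ?thesis
    unfolding perm_order_def by (rule LeastI_ex)
qed

lemma image_core_subset: "\<psi> ` core C D \<psi> \<subseteq> core C D \<psi>"
proof -
  have "\<psi> x \<in> core_seq C D \<psi> k" if "x \<in> core C D \<psi>" for x k
  proof -
    have "x \<in> core_seq C D \<psi> (Suc k)"
      using that unfolding core_def by blast
    then show ?thesis
      by simp
  qed
  then show ?thesis
    unfolding core_def by blast
qed

lemma core_subset: "core C D \<psi> \<subseteq> C"
proof -
  have "core C D \<psi> \<subseteq> core_seq C D \<psi> 0"
    unfolding core_def by blast
  then show ?thesis
    by simp
qed

text \<open>A set that \<open>\<psi>\<close> maps onto itself is closed under images and has
  preimages inside itself, so none of the intersections of the recursion removes any of its
  points.\<close>

lemma invariant_subset_core: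
  assumes "S \<subseteq> C" "\<psi> ` S = S" "\<psi> ` C = D"
  shows "S \<subseteq> core C D \<psi>"
proof -
  have "S \<subseteq> core_seq C D \<psi> k" for k
  proof (induction k)
    case 0
    have "S \<subseteq> \<psi> ` C"
      using assms by (metis image_mono)
    then show ?case
      using assms by simp
  next
    case (Suc k)
    have "S \<subseteq> \<psi> ` core_seq C D \<psi> k"
      using Suc.IH assms(2) by (metis image_mono)
    then show ?case
      using Suc.IH assms by auto
  qed
  then show ?thesis
    by (auto simp: core_def)
qed

text \<open>The sets \<open>T N\<close> of points whose iterates up to \<open>N\<close> stay in
  \<open>C\<close> decrease, and by finiteness they stop changing. The final set is mapped
  injectively into itself, hence onto itself, and therefore lies in the core.\<close>

lemma long_orbits_in_core:
  assumes "finite C" "inj_on \<psi> C" "\<psi> ` C = D"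
  shows "\<exists>K. \<forall>N\<ge>K. \<forall>a. (\<forall>j<N. (\<psi> ^^ j) a \<in> C) \<longrightarrow> a \<in> core C D \<psi>"
proof -
  define T where "T N = {a. \<forall>j\<le>N. (\<psi> ^^ j) a \<in> C}" for N :: nat
  have T: "T N \<subseteq> C" for N
    unfolding T_def by (auto dest: spec[of _ 0])
  then have fin: "finite (T N)" for N
    using assms(1) finite_subset by blast
  \<comment> \<open>Minimal cardinality turns the inclusion of \<open>T (Suc K)\<close> in
    \<open>T K\<close> into an equality.\<close>
  obtain K where K: "\<And>N. card (T K) \<le> card (T N)"
    using ex_has_least_nat[of "\<lambda>_. True" 0 "\<lambda>N. card (T N)"] by auto
  have "T (Suc K) \<subseteq> T K"
    unfolding T_def by auto
  then have eq: "T (Suc K) = T K"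
    using K[of "Suc K"] fin[of K] by (metis card_seteq)
  have "\<psi> ` T K \<subseteq> T K"
  proof -
    have "\<psi> ` T (Suc K) \<subseteq> T K"
    proof clarify
      fix a assume "a \<in> T (Suc K)"
      then have "(\<psi> ^^ Suc j) a \<in> C" if "j \<le> K" for j
        using that unfolding T_def by blast
      then show "\<psi> a \<in> T K"
        by (simp add: T_def funpow_swap1)
    qed
    then show ?thesis
      by (simp add: eq)
  qed
  then have "\<psi> ` T K = T K"
    using fin inj_on_subset[OF assms(2) T] by (intro endo_inj_surj) auto
  then have "T K \<subseteq> core C D \<psi>"
    using invariant_subset_core T assms(3) by metis
  \<comment> \<open>\<open>Suc K\<close> because \<open>T K\<close> bounds the exponents by
    \<open>\<le>\<close> and the claim by \<open><\<close>.\<close>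
  then show ?thesis
    by (intro exI[of _ "Suc K"]) (auto simp: T_def)
qed

section \<open>Abelian powers and quotients of p-groups, and the cyclic gluing\<close>

lemma comm_group_product_group:
  assumes "\<And>i. i \<in> I \<Longrightarrow> comm_group (G i)"
  shows "comm_group (product_group I G)"
proof (rule group.group_comm_groupI)
  show "group (product_group I G)"
    using assms by (simp add: comm_group.axioms(2))
qed (use assms in \<open>auto simp: PiE_iff intro!: restrict_ext comm_monoid.m_comm comm_group.axioms(1)\<close>)

lemma finite_p_group_Mod:
  assumes "Factorial_Ring.prime p" "finite_p_group p G" "H \<lhd> G"
  shows "finite_p_group p (G Mod H)"
proof -
  interpret H: normal H G by fact
  obtain k where k: "card (carrier G) = p ^ k"
    using assms(2) by (auto simp: finite_p_group_def)
  have "card (rcosets\<^bsub>G\<^esub> H) dvd p ^ k"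
    using H.lagrange[OF H.subgroup_axioms] k by (metis dvd_triv_left order_def)
  then have "\<exists>j. card (rcosets\<^bsub>G\<^esub> H) = p ^ j"
    using divides_primepow_nat[OF assms(1)] by blast
  moreover have "finite (rcosets\<^bsub>G\<^esub> H)"
    using assms(2) unfolding finite_p_group_def RCOSETS_def by auto
  ultimately show ?thesis
    by (simp add: finite_p_group_def H.factorgroup_is_group) (simp add: FactGroup_def)
qed

lemma finite_p_group_product:
  assumes "finite I" "finite_p_group p G"
  shows "finite_p_group p (product_group I (\<lambda>_. G))"
proof -
  obtain k where "card (carrier G) = p ^ k"
    using assms(2) by (auto simp: finite_p_group_def)
  then have "card (carrier (product_group I (\<lambda>_. G))) = p ^ (k * card I)"
    using assms(1) by (simp add: card_PiE power_mult)
  then show ?thesis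
    using assms unfolding finite_p_group_def by (auto intro!: finite_PiE)
qed

text \<open>The quotient of \<open>Z\<^sup>N\<close> identifying \<open>a \<in> C\<close> in position \<open>m\<close> with \<open>\<psi> a\<close> in position \<open>m - 1\<close>
  (cyclically). An element \<open>z\<close> of a single position dies exactly if \<open>z = a (\<psi>\<^sup>N a)\<^sup>-\<^sup>1\<close> for some \<open>a\<close> in the
  domain of \<open>\<psi>\<^sup>N\<close>, hence the assumption \<open>orbits\<close>.\<close>
locale cyclic_gluing = comm_group Z for Z (structure) +
  fixes C :: "'a set" and \<psi> :: "'a \<Rightarrow> 'a" and N :: nat
  assumes C: "subgroup C Z" and hom: "\<psi> \<in> hom (Z\<lparr>carrier := C\<rparr>) Z"
    and N: "0 < N"
    and orbits: "\<And>a. (\<And>j. j < N \<Longrightarrow> (\<psi> ^^ j) a \<in> C) \<Longrightarrow> (\<psi> ^^ N) a = a"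
begin

definition index :: "int set" where "index = {0..<int N}"

definition pred :: "int \<Rightarrow> int" where "pred m = (m - 1) mod int N"

definition power :: "(int \<Rightarrow> 'a) monoid" where "power = product_group index (\<lambda>_. Z)"

text \<open>A product of relators: the entry \<open>a (pred m)\<close> contributes itself in
  position \<open>m\<close> and the inverse of its image under \<open>\<psi>\<close> in position
  \<open>pred m\<close>.\<close>

definition rel :: "(int \<Rightarrow> 'a) \<Rightarrow> int \<Rightarrow> 'a" where
  "rel a = (\<lambda>m\<in>index. a (pred m) \<otimes> inv \<psi> (a m))"

definition rels :: "(int \<Rightarrow> 'a) set" where "rels = rel ` (index \<rightarrow>\<^sub>E C)"

definition single :: "int \<Rightarrow> 'a \<Rightarrow> int \<Rightarrow> 'a" where
  "single m z = (\<lambda>i\<in>index. if i = m then z else \<one>)"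

definition glue :: "int \<Rightarrow> 'a \<Rightarrow> (int \<Rightarrow> 'a) set" where
  "glue m z = rels #>\<^bsub>power\<^esub> single m z"

lemma pred_index: "pred m \<in> index"
  using N by (simp add: pred_def index_def)

lemma pred_inj: "i \<in> index \<Longrightarrow> j \<in> index \<Longrightarrow> pred i = pred j \<longleftrightarrow> i = j"
proof -
  assume ij: "i \<in> index" "j \<in> index"
  have "i = j" if "pred i = pred j"
  proof -
    have "(i - 1 + 1) mod int N = (j - 1 + 1) mod int N"
      using that unfolding pred_def by (metis mod_add_left_eq)
    then show ?thesis
      using ij by (simp add: index_def)
  qed
  then show ?thesis by auto
qed

lemma C_carrier: "a \<in> C \<Longrightarrow> a \<in> carrier Z"
  using C subgroup.subset by blast

lemma psi_closed: "a \<in> C \<Longrightarrow> \<psi> a \<in> carrier Z"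
  using hom by (auto simp: hom_def)

lemma psi_mult: "a \<in> C \<Longrightarrow> b \<in> C \<Longrightarrow> \<psi> (a \<otimes> b) = \<psi> a \<otimes> \<psi> b"
  using hom by (auto simp: hom_def)

lemma psi_one: "\<psi> \<one> = \<one>"
  using psi_mult[of \<one> \<one>] psi_closed[of \<one>] subgroup.one_closed[OF C] by simp

lemma comm_group_power: "comm_group power"
  unfolding power_def by (rule comm_group_product_group) (rule comm_group_axioms)

text \<open>Since \<open>Z\<close> is abelian, \<open>rel\<close> is a homomorphism on the power of
  \<open>C\<close>, and \<open>rels\<close> is its image.\<close>

lemma rels_subgroup: "subgroup rels power"
proof -
  have gC: "group (Z\<lparr>carrier := C\<rparr>)"
    by (simp add: C subgroup_imp_group)
  have "rel \<in> hom (product_group index (\<lambda>_. Z\<lparr>carrier := C\<rparr>)) power"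
    by (auto simp: hom_def power_def rel_def PiE_iff pred_index C_carrier psi_closed psi_mult
        inv_mult m_ac intro!: restrict_ext)
  then have "group_hom (product_group index (\<lambda>_. Z\<lparr>carrier := C\<rparr>)) power rel"
    using gC comm_group_power
    by (simp add: group_hom_def group_hom_axioms_def comm_group.axioms(2))
  from group_hom.img_is_subgroup[OF this] show ?thesis
    by (simp add: rels_def)
qed

lemma rels_normal: "rels \<lhd> power"
  using comm_group.normal_iff_subgroup[OF comm_group_power] rels_subgroup by simp

lemma single_hom: "single m \<in> hom Z power"
  by (auto simp: hom_def power_def single_def intro!: restrict_ext)

lemma glue_hom: "glue m \<in> hom Z (power Mod rels)"
  using Group.hom_compose[OF single_hom normal.r_coset_hom_Mod[OF rels_normal], of m]
  by (simp add: glue_def[abs_def] comp_def)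

lemma glue_pred:
  assumes "m \<in> index" "a \<in> C"
  shows "glue m a = glue (pred m) (\<psi> a)"
proof -
  interpret P: comm_group power by (rule comm_group_power)
  \<comment> \<open>A relator is indexed by the lower of its two positions, so the entry that
    relates \<open>m\<close> to \<open>pred m\<close> sits at \<open>pred m\<close>.\<close>
  define b where "b = (\<lambda>i\<in>index. if i = pred m then a else \<one>)"
  have b: "b \<in> index \<rightarrow>\<^sub>E C"
    using assms(2) subgroup.one_closed[OF C] by (simp add: b_def)
  then have rel: "rel b \<in> rels"
    by (simp add: rels_def)
  have "single m a = rel b \<otimes>\<^bsub>power\<^esub> single (pred m) (\<psi> a)"
    using assms
    by (auto simp: power_def single_def rel_def b_def pred_index pred_inj psi_one psi_closed C_carrier
        m_assoc intro!: restrict_ext)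
  moreover have "rel b \<in> carrier power"
    using rel rels_subgroup subgroup.subset by blast
  moreover have "single (pred m) (\<psi> a) \<in> carrier power"
    using single_hom psi_closed[OF assms(2)] by (rule hom_in_carrier)
  ultimately show ?thesis
    unfolding glue_def using rel rels_subgroup subgroup.subset[OF rels_subgroup]
    by (metis P.coset_join2 P.coset_mult_assoc)
qed

text \<open>If \<open>single m z = rel a\<close>, the coordinates other than \<open>m\<close> say
  \<open>a (pred i) = \<psi> (a i)\<close>, so walking backwards once around the cycle applies
  \<open>\<psi>\<close> at each step. Coordinate \<open>m\<close> closes the cycle and gives
  \<open>z (\<psi> ^^ N) x = x\<close> for \<open>x = a (pred m)\<close>; by \<open>orbits\<close>
  the power fixes \<open>x\<close>, so \<open>z\<close> is trivial.\<close>

lemma glue_inj: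
  assumes "m \<in> index"
  shows "inj_on (glue m) (carrier Z)"
proof -
  interpret P: comm_group power by (rule comm_group_power)
  have gh: "group_hom Z (power Mod rels) (glue m)"
    using glue_hom normal.factorgroup_is_group[OF rels_normal]
    by (simp add: group_hom_def group_hom_axioms_def is_group)
  have "z = \<one>" if z: "z \<in> carrier Z" and "glue m z = \<one>\<^bsub>power Mod rels\<^esub>" for z
  proof -
    have "rels #>\<^bsub>power\<^esub> single m z = rels"
      using that(2) by (simp add: glue_def)
    then have "single m z \<in> rels"
      using P.coset_join1 rels_subgroup hom_in_carrier[OF single_hom z] by blast
    then obtain a where a: "a \<in> index \<rightarrow>\<^sub>E C" and sa: "single m z = rel a"
      by (auto simp: rels_def)
    have aC: "a i \<in> C" if "i \<in> index" for i
      using a that by blast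
    have at: "(if i = m then z else \<one>) \<otimes> \<psi> (a i) = a (pred i)" if "i \<in> index" for i
    proof -
      have "(if i = m then z else \<one>) = a (pred i) \<otimes> inv \<psi> (a i)"
        using fun_cong[OF sa, of i] that by (simp add: single_def rel_def)
      then show ?thesis
        using aC[OF that] aC[OF pred_index] by (simp add: m_assoc psi_closed C_carrier)
    qed
    \<comment> \<open>The entries of \<open>a\<close> read backwards: \<open>b 0\<close> is the
      entry at \<open>pred m\<close> and \<open>b (N - 1)\<close> the one at
      \<open>m\<close>.\<close>
    define b where "b j = a ((m - 1 - int j) mod int N)" for j
    have b_mem: "b j \<in> C" for j
      unfolding b_def using N by (intro aC) (simp add: index_def)
    have b_Suc: "b (Suc j) = \<psi> (b j)" if "Suc j < N" for j
    proof -
      let ?i = "(m - 1 - int j) mod int N"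
      have i: "?i \<in> index"
        using N by (simp add: index_def)
      \<comment> \<open>The walk meets \<open>m\<close> only at \<open>j = N - 1\<close>, which
        \<open>Suc j < N\<close> excludes.\<close>
      have "?i \<noteq> m"
      proof
        assume "?i = m"
        then have "(m - 1 - int j) mod int N = m mod int N"
          using assms by (simp add: index_def)
        then have "int N dvd (m - 1 - int j) - m"
          by (simp add: mod_eq_dvd_iff)
        then have "int N dvd int (Suc j)"
          by (metis (no_types, opaque_lifting) add_uminus_conv_diff diff_diff_eq dvd_minus_iff 
              add_diff_cancel_left' of_nat_Suc)
        then show False
          using that by (metis dvd_imp_le int_dvd_int_iff not_less zero_less_Suc)
      qed
      moreover have "pred ?i = (m - 1 - int (Suc j)) mod int N"
        unfolding pred_def by (simp add: mod_diff_left_eq algebra_simps)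
      ultimately show ?thesis
        using at[OF i] psi_closed[OF aC[OF i]] by (simp add: b_def)
    qed
    have b_pow: "b j = (\<psi> ^^ j) (b 0)" if "j < N" for j
      using that by (induction j) (auto simp: b_Suc)
    have "(\<psi> ^^ N) (b 0) = b 0"
      using b_pow b_mem by (intro orbits) metis
    moreover have "(\<psi> ^^ N) (b 0) = \<psi> (b (N - 1))"
      using N b_pow[of "N - 1"] by (cases N) auto
    moreover have "b (N - 1) = a m"
    proof -
      have "(m - 1 - int (N - 1)) mod int N = (m - int N) mod int N"
        using N by (simp add: of_nat_diff)
      also have "\<dots> = m"
        using assms by (simp add: index_def)
      finally show ?thesis
        by (simp add: b_def)
    qed
    moreover have "z \<otimes> \<psi> (a m) = b 0"
      using at[OF assms] by (simp add: b_def pred_def)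
    ultimately have "z \<otimes> b 0 = b 0"
      by simp
    then show ?thesis
      using z C_carrier[OF b_mem[of 0]] by simp
  qed
  then show ?thesis
    using group_hom.inj_on_one_iff[OF gh] by blast
qed

end

text \<open>If \<open>N\<close> is large, a point with \<open>N\<close> iterates in \<open>C\<close>
  lies in the core; if \<open>p ^ k\<close> divides \<open>N\<close>, the \<open>N\<close>-th power
  of \<open>\<psi>\<close> is the identity there. A power of \<open>p\<close> with both properties
  satisfies the assumption \<open>orbits\<close> of the cyclic gluing.\<close>

lemma abelian_gluing:
  fixes Z :: "'z monoid"
  assumes "Factorial_Ring.prime p" "comm_group Z" "finite_p_group p Z" "subgroup C Z"
    and hom: "\<psi> \<in> hom (Z\<lparr>carrier := C\<rparr>) Z" and inj: "inj_on \<psi> C" and img: "\<psi> ` C = D"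
    and ord: "perm_order (core C D \<psi>) \<psi> = p ^ k"
  obtains r and W :: "(int \<Rightarrow> 'z) set monoid" and \<zeta> where
    "comm_group W" "finite_p_group p W" "\<And>m. \<zeta> m \<in> hom Z W"
    "\<And>m. m \<in> {0..<int (p ^ r)} \<Longrightarrow> inj_on (\<zeta> m) (carrier Z)"
    "\<And>m a. m \<in> {0..<int (p ^ r)} \<Longrightarrow> a \<in> C \<Longrightarrow> \<zeta> m a = \<zeta> ((m - 1) mod int (p ^ r)) (\<psi> a)"
proof -
  interpret Z: comm_group Z by fact
  have fin: "finite C"
    using assms(3,4) subgroup.subset finite_subset unfolding finite_p_group_def by metis
  from long_orbits_in_core[OF this inj img] obtain K where K:
    "\<And>N a. K \<le> N \<Longrightarrow> (\<And>j. j < N \<Longrightarrow> (\<psi> ^^ j) a \<in> C) \<Longrightarrow> a \<in> core C D \<psi>"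
    by blast
  have "finite (core C D \<psi>)" "inj_on \<psi> (core C D \<psi>)"
    using finite_subset[OF core_subset fin] inj_on_subset[OF inj core_subset] by auto
  from perm_order_funpow[OF this(1) image_core_subset this(2)]
  have per: "(\<psi> ^^ p ^ k) x = x" if "x \<in> core C D \<psi>" for x
    using that by (simp add: ord)
  have per': "(\<psi> ^^ (p ^ k * q)) x = x" if "x \<in> core C D \<psi>" for x q
    using that by (induction q) (simp_all add: funpow_add per)
  have p2: "2 \<le> p"
    using assms(1) prime_ge_2_nat by blast
  \<comment> \<open>The factor \<open>p ^ k\<close> is the period on the core, and
    \<open>p ^ K\<close> makes \<open>N\<close> at least \<open>K\<close>.\<close>
  define N where "N = p ^ (k + K)"
  have "K < 2 ^ K"
    by (rule less_exp)
  also have "\<dots> \<le> p ^ K"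
    using p2 by (intro power_mono) auto
  also have "\<dots> \<le> N"
    unfolding N_def using p2 by (intro power_increasing) auto
  finally have "K \<le> N"
    by simp
  interpret cyclic_gluing Z C \<psi> N
  proof (intro cyclic_gluing.intro cyclic_gluing_axioms.intro)
    show "0 < N"
      using p2 by (simp add: N_def)
    show "(\<psi> ^^ N) a = a" if "\<And>j. j < N \<Longrightarrow> (\<psi> ^^ j) a \<in> C" for a
      using per'[OF K[OF \<open>K \<le> N\<close> that], of "p ^ K"] by (simp add: N_def power_add)
  qed fact+
  show thesis
  proof (rule that)
    show "comm_group (power Mod rels)"
      using comm_group.abelian_FactGroup[OF comm_group_power rels_subgroup] .
    show "finite_p_group p (power Mod rels)"
      using finite_p_group_Mod[OF assms(1) _ rels_normal] finite_p_group_product[OF _ assms(3)]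
      unfolding power_def index_def by blast
    show "\<And>m. glue m \<in> hom Z (power Mod rels)"
      by (rule glue_hom)
    show "inj_on (glue m) (carrier Z)" if "m \<in> {0..<int (p ^ (k + K))}" for m
      using that glue_inj[of m] unfolding index_def unfolding N_def by blast
    show "glue m a = glue ((m - 1) mod int (p ^ (k + K))) (\<psi> a)"
      if "m \<in> {0..<int (p ^ (k + K))}" "a \<in> C" for m a
      using that glue_pred[of m a] unfolding index_def pred_def unfolding N_def by blast
  qed
qed

lemma finite_p_group_subgroup:
  assumes "Factorial_Ring.prime p" "finite_p_group p G" "subgroup H G"
  shows "finite_p_group p (G\<lparr>carrier := H\<rparr>)"
proof -
  interpret group G
    using assms(2) by (simp add: finite_p_group_def)
  obtain k where "order G = p ^ k"
    using assms(2) by (auto simp: finite_p_group_def order_def)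
  then have "card H dvd p ^ k"
    using lagrange[OF assms(3)] by (metis dvd_triv_right)
  then have "\<exists>j. card H = p ^ j"
    using divides_primepow_nat[OF assms(1)] by blast
  moreover have "finite H"
    using assms(2) subgroup.subset[OF assms(3)] finite_subset unfolding finite_p_group_def by blast
  ultimately show ?thesis
    using subgroup_imp_group[OF assms(3)] by (simp add: finite_p_group_def)
qed

section \<open>The gluing for one layer of the filtration\<close>

text \<open>The layer \<open>L/M\<close> is abelian because it is central in \<open>G/M\<close>. The
  maps \<open>\<zeta>\<close> are the embeddings of \<open>abelian_gluing\<close> for this layer and
  the map induced by \<open>\<phi>\<close>, pulled back along the quotient map
  \<open>q\<close>.\<close>

lemma filtration_quotient_gluing:
  fixes G :: "'a monoid"
  assumes p: "Factorial_Ring.prime p" and G: "finite_p_group p G"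
    and A: "subgroup A G" and B: "subgroup B G"
    and iso: "\<phi> \<in> iso (G\<lparr>carrier := A\<rparr>) (G\<lparr>carrier := B\<rparr>)"
    and L: "L \<lhd> G" and M: "M \<lhd> G"
    and central: "\<forall>x\<in>L. \<forall>y\<in>carrier G.
      x \<otimes>\<^bsub>G\<^esub> y \<otimes>\<^bsub>G\<^esub> inv\<^bsub>G\<^esub> x \<otimes>\<^bsub>G\<^esub> inv\<^bsub>G\<^esub> y \<in> M"
    and compL: "\<phi> ` (A \<inter> L) = B \<inter> L" and compM: "\<phi> ` (A \<inter> M) = B \<inter> M"
    and ord: "perm_order (core (quot_dom G A L M) (quot_dom G B L M) (quot_map G A \<phi> L M))
      (quot_map G A \<phi> L M) = p ^ k"
  obtains r and W :: "(int \<Rightarrow> 'a set) set monoid" and \<zeta> where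
    "comm_group W" "finite_p_group p W" "\<forall>m. \<zeta> m \<in> hom (G\<lparr>carrier := L\<rparr>) W"
    "\<forall>m\<in>{0..<int (p ^ r)}. \<forall>x\<in>L. \<zeta> m x = \<one>\<^bsub>W\<^esub> \<longleftrightarrow> x \<in> M"
    "\<forall>m\<in>{0..<int (p ^ r)}. \<forall>a\<in>A \<inter> L. \<zeta> m a = \<zeta> ((m - 1) mod int (p ^ r)) (\<phi> a)"
    "\<forall>m. \<forall>x\<in>L. \<forall>g\<in>carrier G. \<zeta> m (g \<otimes>\<^bsub>G\<^esub> x \<otimes>\<^bsub>G\<^esub> inv\<^bsub>G\<^esub> g) = \<zeta> m x"
proof -
  interpret G: group G
    using G by (simp add: finite_p_group_def)
  interpret L: normal L G by fact
  interpret M: normal M G by fact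
  note Lc = subgroup.mem_carrier[OF L.subgroup_axioms]
  note Ac = subgroup.mem_carrier[OF A] and Bc = subgroup.mem_carrier[OF B]
  define q where "q g = M #>\<^bsub>G\<^esub> g" for g
  have q_hom: "q \<in> hom G (G Mod M)"
    using M.r_coset_hom_Mod by (simp add: q_def[abs_def])
  have q_mult: "q (x \<otimes>\<^bsub>G\<^esub> y) = q x \<otimes>\<^bsub>G Mod M\<^esub> q y" if "x \<in> carrier G" "y \<in> carrier G" for x y
    using hom_mult[OF q_hom that] .
  interpret Q: group "G Mod M"
    by (rule M.factorgroup_is_group)
  interpret q: group_hom G "G Mod M" q
    using q_hom by unfold_locales
  note q.hom_mult [simp del] mult_FactGroup [simp del]
  have q_one: "q x = \<one>\<^bsub>G Mod M\<^esub> \<longleftrightarrow> x \<in> M" if "x \<in> carrier G" for x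
    using M.rcos_const[OF G.group_axioms] G.coset_join1[OF _ that M.subgroup_axioms] M.subset by (auto simp: q_def)
  have q_eq: "q x = q y \<longleftrightarrow> x \<otimes>\<^bsub>G\<^esub> inv\<^bsub>G\<^esub> y \<in> M" if "x \<in> carrier G" "y \<in> carrier G" for x y
  proof -
    have "q (x \<otimes>\<^bsub>G\<^esub> inv\<^bsub>G\<^esub> y) = q x \<otimes>\<^bsub>G Mod M\<^esub> inv\<^bsub>G Mod M\<^esub> q y"
      using that by (simp only: q.hom_mult q.hom_inv G.inv_closed)
    then show ?thesis
      using that q_one[of "x \<otimes>\<^bsub>G\<^esub> inv\<^bsub>G\<^esub> y"] q.hom_closed
      by (metis G.inv_closed G.m_closed Q.inv_closed Q.inv_inv Q.inv_equality Q.r_inv)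
  qed
  have \<phi>_mult: "\<phi> (x \<otimes>\<^bsub>G\<^esub> y) = \<phi> x \<otimes>\<^bsub>G\<^esub> \<phi> y" if "x \<in> A" "y \<in> A" for x y
    using iso that by (auto simp: iso_def hom_def)
  have \<phi>_B: "\<phi> x \<in> B" if "x \<in> A" for x
    using iso that by (auto simp: iso_def hom_def)
  have \<phi>_inj: "inj_on \<phi> A"
    using iso by (simp add: iso_def bij_betw_def)
  have \<phi>_inv: "\<phi> (inv\<^bsub>G\<^esub> x) = inv\<^bsub>G\<^esub> \<phi> x" if "x \<in> A" for x
  proof -
    have "\<phi> \<one>\<^bsub>G\<^esub> = \<one>\<^bsub>G\<^esub>"
      using \<phi>_mult[of "\<one>\<^bsub>G\<^esub>" "\<one>\<^bsub>G\<^esub>"] Bc[OF \<phi>_B[of "\<one>\<^bsub>G\<^esub>"]] subgroup.one_closed[OF A] by simp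
    then have "\<phi> (inv\<^bsub>G\<^esub> x) \<otimes>\<^bsub>G\<^esub> \<phi> x = \<one>\<^bsub>G\<^esub>"
      using \<phi>_mult[of "inv\<^bsub>G\<^esub> x" x] that subgroup.m_inv_closed[OF A] Ac by simp
    then show ?thesis
      using that Bc \<phi>_B subgroup.m_inv_closed[OF A] G.inv_equality by metis
  qed
  have \<phi>_M: "\<phi> x \<in> M \<longleftrightarrow> x \<in> M" if "x \<in> A" for x
    using compM \<phi>_B[OF that] \<phi>_inj that by (auto dest: inj_onD)
  have \<phi>_L: "\<phi> x \<in> L" if "x \<in> A \<inter> L" for x
    using compL that by blast
  define C where "C = quot_dom G A L M"
  define D where "D = quot_dom G B L M"
  define \<psi> where "\<psi> = quot_map G A \<phi> L M"
  have C_eq: "C = q ` (A \<inter> L)" and D_eq: "D = q ` (B \<inter> L)"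
    by (auto simp: C_def D_def quot_dom_def q_def)
  \<comment> \<open>One direction makes the induced map well defined, the other makes it
    injective.\<close>
  have q_\<phi>: "q (\<phi> a) = q (\<phi> b) \<longleftrightarrow> q a = q b" if "a \<in> A" "b \<in> A" for a b
  proof -
    have "\<phi> a \<otimes>\<^bsub>G\<^esub> inv\<^bsub>G\<^esub> \<phi> b = \<phi> (a \<otimes>\<^bsub>G\<^esub> inv\<^bsub>G\<^esub> b)"
      using that by (simp add: \<phi>_mult \<phi>_inv subgroup.m_inv_closed[OF A])
    then show ?thesis
      using that \<phi>_M[of "a \<otimes>\<^bsub>G\<^esub> inv\<^bsub>G\<^esub> b"] subgroup.m_inv_closed[OF A] subgroup.m_closed[OF A]
      by (simp add: q_eq Ac Bc \<phi>_B)
  qed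
  \<comment> \<open>\<open>quot_map\<close> picks a representative by \<open>SOME\<close>; by
    \<open>q_\<phi>\<close> any choice gives the same coset.\<close>
  have \<psi>_q: "\<psi> (q a) = q (\<phi> a)" if "a \<in> A \<inter> L" for a
  proof -
    have "a \<in> q a \<inter> A \<inter> L"
      using that Ac G.rcos_self[OF _ M.subgroup_axioms] by (auto simp: q_def)
    then have some: "(SOME x. x \<in> q a \<inter> A \<inter> L) \<in> q a \<inter> A \<inter> L"
      by (rule someI)
    moreover from this have "q (SOME x. x \<in> q a \<inter> A \<inter> L) = q a"
      using G.repr_independence[OF _ _ M.subgroup_axioms, of _ a] that Ac by (auto simp: q_def)
    ultimately show ?thesis
      using q_\<phi> that unfolding \<psi>_def quot_map_def q_def[symmetric] by blast
  qed
  define Z where "Z = (G Mod M)\<lparr>carrier := q ` L\<rparr>"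
  have Z_sub: "subgroup (q ` L) (G Mod M)"
    by (rule q.subgroup_img_is_subgroup[OF L.subgroup_axioms])
  have Z_group: "group Z"
    unfolding Z_def by (rule Q.subgroup_imp_group[OF Z_sub])
  have Z_comm: "comm_group Z"
  proof (rule group.group_comm_groupI[OF Z_group])
    fix U V assume "U \<in> carrier Z" "V \<in> carrier Z"
    then obtain x y where xy: "U = q x" "V = q y" "x \<in> L" "y \<in> L"
      by (auto simp: Z_def)
    have "q (x \<otimes>\<^bsub>G\<^esub> y) = q (y \<otimes>\<^bsub>G\<^esub> x)"
      using central[rule_format, OF xy(3) Lc[OF xy(4)]] xy Lc by (simp add: q_eq G.inv_mult_group G.m_assoc)
    then show "U \<otimes>\<^bsub>Z\<^esub> V = V \<otimes>\<^bsub>Z\<^esub> U"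
      using xy Lc by (simp add: Z_def q_mult)
  qed
  have Z_p: "finite_p_group p Z"
    unfolding Z_def using finite_p_group_subgroup[OF p finite_p_group_Mod[OF p G M] Z_sub] .
  have "subgroup (A \<inter> L) G"
    using G.subgroups_Inter_pair A L.subgroup_axioms by blast
  from q.subgroup_img_is_subgroup[OF this]
  have C_sub: "subgroup C Z"
    unfolding Z_def using Q.subgroup_incl[OF _ Z_sub] C_eq by blast
  have \<psi>_hom: "\<psi> \<in> hom (Z\<lparr>carrier := C\<rparr>) Z"
  proof (rule homI)
    fix U assume "U \<in> carrier (Z\<lparr>carrier := C\<rparr>)"
    then show "\<psi> U \<in> carrier Z"
      using \<psi>_q \<phi>_L by (auto simp: C_eq Z_def)
  next
    fix U V assume "U \<in> carrier (Z\<lparr>carrier := C\<rparr>)" "V \<in> carrier (Z\<lparr>carrier := C\<rparr>)"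
    then obtain x y where xy: "U = q x" "V = q y" "x \<in> A \<inter> L" "y \<in> A \<inter> L"
      by (auto simp: C_eq)
    then have "x \<otimes>\<^bsub>G\<^esub> y \<in> A \<inter> L"
      using subgroup.m_closed[OF A] by auto
    then have "\<psi> (q (x \<otimes>\<^bsub>G\<^esub> y)) = q (\<phi> x \<otimes>\<^bsub>G\<^esub> \<phi> y)"
      using xy by (simp add: \<psi>_q \<phi>_mult)
    then show "\<psi> (U \<otimes>\<^bsub>Z\<lparr>carrier := C\<rparr>\<^esub> V) = \<psi> U \<otimes>\<^bsub>Z\<^esub> \<psi> V"
      using xy Ac Bc \<phi>_B by (simp add: Z_def q_mult \<psi>_q)
  qed
  have \<psi>_inj: "inj_on \<psi> C"
    using q_\<phi> by (auto simp: inj_on_def C_eq \<psi>_q)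
  have \<psi>_img: "\<psi> ` C = D"
  proof -
    have "\<psi> ` C = q ` \<phi> ` (A \<inter> L)"
      unfolding C_eq image_image using \<psi>_q by (intro image_cong) auto
    then show ?thesis
      by (simp add: compL D_eq)
  qed
  obtain r and W :: "(int \<Rightarrow> 'a set) set monoid" and \<zeta> where W:
    "comm_group W" "finite_p_group p W" and \<zeta>_hom: "\<And>m. \<zeta> m \<in> hom Z W"
    and \<zeta>_inj: "\<And>m. m \<in> {0..<int (p ^ r)} \<Longrightarrow> inj_on (\<zeta> m) (carrier Z)"
    and \<zeta>_pred: "\<And>m a. m \<in> {0..<int (p ^ r)} \<Longrightarrow> a \<in> C \<Longrightarrow> \<zeta> m a = \<zeta> ((m - 1) mod int (p ^ r)) (\<psi> a)"
    using abelian_gluing[OF p Z_comm Z_p C_sub \<psi>_hom \<psi>_inj \<psi>_img ord[folded C_def D_def \<psi>_def]]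
    by metis
  have "q \<in> hom (G\<lparr>carrier := L\<rparr>) Z"
    using Lc by (auto simp: hom_def Z_def q_mult)
  from Group.hom_compose[OF this \<zeta>_hom]
  have 1: "(\<lambda>x. \<zeta> m (q x)) \<in> hom (G\<lparr>carrier := L\<rparr>) W" for m
    by (simp add: comp_def)
  have 2: "\<zeta> m (q x) = \<one>\<^bsub>W\<^esub> \<longleftrightarrow> x \<in> M" if "m \<in> {0..<int (p ^ r)}" "x \<in> L" for m x
  proof -
    have "\<zeta> m \<one>\<^bsub>Z\<^esub> = \<one>\<^bsub>W\<^esub>"
      using hom_one[OF \<zeta>_hom Z_group] W(1) by (simp add: comm_group.axioms(2))
    moreover have "\<one>\<^bsub>Z\<^esub> \<in> carrier Z"
      by (simp add: Z_group group.is_monoid)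
    ultimately have "\<zeta> m (q x) = \<one>\<^bsub>W\<^esub> \<longleftrightarrow> q x = \<one>\<^bsub>Z\<^esub>"
      using inj_on_eq_iff[OF \<zeta>_inj[OF that(1)], of "q x" "\<one>\<^bsub>Z\<^esub>"] that(2) by (simp add: Z_def)
    also have "\<dots> \<longleftrightarrow> x \<in> M"
      using q_one Lc that(2) by (simp add: Z_def)
    finally show ?thesis .
  qed
  have 3: "\<zeta> m (q a) = \<zeta> ((m - 1) mod int (p ^ r)) (q (\<phi> a))"
    if "m \<in> {0..<int (p ^ r)}" "a \<in> A \<inter> L" for m a
    using \<zeta>_pred[OF that(1), of "q a"] that(2) \<psi>_q by (simp add: C_eq)
  \<comment> \<open>The commutator of \<open>x\<close> and \<open>g\<close> lies in
    \<open>M\<close>, so conjugating \<open>x\<close> by \<open>g\<close> does not change its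
    coset.\<close>
  have 4: "\<zeta> m (q (g \<otimes>\<^bsub>G\<^esub> x \<otimes>\<^bsub>G\<^esub> inv\<^bsub>G\<^esub> g)) = \<zeta> m (q x)" if "x \<in> L" "g \<in> carrier G" for m x g
  proof -
    have "q x = q (g \<otimes>\<^bsub>G\<^esub> x \<otimes>\<^bsub>G\<^esub> inv\<^bsub>G\<^esub> g)"
      using that Lc central[rule_format, OF that]
      by (simp add: q_eq G.inv_mult_group G.m_assoc)
    then show ?thesis
      by simp
  qed
  show thesis
    by (rule that[OF W, of "\<lambda>m x. \<zeta> m (q x)" r]; intro allI ballI; rule 1 2 3 4; assumption)
qed

section \<open>Lifting a realization along a central layer\<close>

text \<open>\<open>H\<close> acts on \<open>P\<close> by left multiplication through
  \<open>f\<close>, and \<open>s y\<close> carries \<open>y\<close> to a representative of its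
  orbit. The representative is chosen from the orbit as a set, so it is the same for all points of
  the orbit.\<close>

lemma orbit_section:
  assumes "group G" "group P" "f \<in> hom G P" "subgroup H G"
  obtains s where "\<forall>y\<in>carrier P. s y \<in> H"
    "\<forall>y\<in>carrier P. \<forall>h\<in>H.
      f (s (f h \<otimes>\<^bsub>P\<^esub> y)) \<otimes>\<^bsub>P\<^esub> (f h \<otimes>\<^bsub>P\<^esub> y) = f (s y) \<otimes>\<^bsub>P\<^esub> y"
proof -
  interpret G: group G by fact
  interpret P: group P by fact
  interpret f: group_hom G P f
    using assms(3) by unfold_locales
  note Hc = subgroup.mem_carrier[OF assms(4)]
  define orb where "orb y = {f h \<otimes>\<^bsub>P\<^esub> y | h. h \<in> H}" for y
  define r where "r y = (SOME z. z \<in> orb y)" for y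
  define s where "s y = (SOME h. h \<in> H \<and> f h \<otimes>\<^bsub>P\<^esub> y = r y)" for y
  have "orb y \<noteq> {}" for y
    using subgroup.one_closed[OF assms(4)] by (auto simp: orb_def)
  then have r: "r y \<in> orb y" for y
    unfolding r_def by (simp add: some_in_eq)
  have "\<exists>h. h \<in> H \<and> f h \<otimes>\<^bsub>P\<^esub> y = r y" for y
    using r[of y] unfolding orb_def by force
  from someI_ex[OF this] have s: "s y \<in> H" "f (s y) \<otimes>\<^bsub>P\<^esub> y = r y" for y
    unfolding s_def by auto
  have "r (f h \<otimes>\<^bsub>P\<^esub> y) = r y" if y: "y \<in> carrier P" and h: "h \<in> H" for y h
  proof -
    have "f k \<otimes>\<^bsub>P\<^esub> (f h \<otimes>\<^bsub>P\<^esub> y) = f (k \<otimes>\<^bsub>G\<^esub> h) \<otimes>\<^bsub>P\<^esub> y" if "k \<in> H" for k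
      using that h y Hc by (simp add: P.m_assoc)
    then have "orb (f h \<otimes>\<^bsub>P\<^esub> y) \<subseteq> orb y"
      using subgroup.m_closed[OF assms(4) _ h] by (auto simp: orb_def)
    moreover have "f k \<otimes>\<^bsub>P\<^esub> y = f (k \<otimes>\<^bsub>G\<^esub> inv\<^bsub>G\<^esub> h) \<otimes>\<^bsub>P\<^esub> (f h \<otimes>\<^bsub>P\<^esub> y)" if "k \<in> H" for k
    proof -
      have "f (k \<otimes>\<^bsub>G\<^esub> inv\<^bsub>G\<^esub> h) \<otimes>\<^bsub>P\<^esub> f h = f k"
        using that h Hc by (simp add: P.m_assoc)
      then show ?thesis
        using that h y Hc by (metis P.m_assoc G.inv_closed G.m_closed f.hom_closed)
    qed
    then have "orb y \<subseteq> orb (f h \<otimes>\<^bsub>P\<^esub> y)"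
      using subgroup.m_closed[OF assms(4) _ subgroup.m_inv_closed[OF assms(4) h]]
      by (auto simp: orb_def)
    ultimately have "orb (f h \<otimes>\<^bsub>P\<^esub> y) = orb y"
      by blast
    then show ?thesis
      by (simp add: r_def)
  qed
  then show thesis
    using s by (intro that[of s]) auto
qed

text \<open>The wreath product acts on the trivial \<open>W\<close>-bundle over \<open>P\<close>. Its restriction to a \<open>G\<close>-orbit of degree \<open>m\<close> is
  identified with \<open>G \<times>\<^sub>L W\<close> formed along \<open>\<zeta> m\<close>; the sections \<open>s\<close> and \<open>\<alpha>\<close> carry points to representatives of
  their \<open>G\<close>- and \<open>A\<close>-orbits. The obstruction \<open>c\<close> to lifting \<open>\<tau>\<close> is an \<open>A\<close>-cocycle that is trivial on the
  stabilizers \<open>A \<inter> L\<close>, hence the coboundary of \<open>v\<close>.\<close>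
locale realization_lift =
  G: group G + P: group P + W: comm_group W
  for G :: "('a, 'b) monoid_scheme" and P :: "('p, 'q) monoid_scheme" and W :: "('w, 'r) monoid_scheme" +
  fixes A L M :: "'a set" and \<phi> :: "'a \<Rightarrow> 'a" and f :: "'a \<Rightarrow> 'p" and \<tau> :: 'p
    and \<zeta> :: "'i \<Rightarrow> 'a \<Rightarrow> 'w" and I :: "'i set" and pred :: "'i \<Rightarrow> 'i" and deg :: "'p \<Rightarrow> 'i"
    and s \<alpha> :: "'p \<Rightarrow> 'a"
  assumes f_hom: "f \<in> hom G P" and \<tau>: "\<tau> \<in> carrier P"
    and A: "subgroup A G" and L: "L \<lhd> G" and M_subset: "M \<subseteq> L"
    and \<phi>: "\<phi> \<in> hom (G\<lparr>carrier := A\<rparr>) G"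
    and rel: "\<And>a. a \<in> A \<Longrightarrow> f a \<otimes>\<^bsub>P\<^esub> \<tau> = \<tau> \<otimes>\<^bsub>P\<^esub> f (\<phi> a)"
    and ker: "\<And>g. g \<in> carrier G \<Longrightarrow> f g = \<one>\<^bsub>P\<^esub> \<longleftrightarrow> g \<in> L"
    and \<zeta>_hom: "\<And>m. \<zeta> m \<in> hom (G\<lparr>carrier := L\<rparr>) W"
    and \<zeta>_ker: "\<And>m x. m \<in> I \<Longrightarrow> x \<in> L \<Longrightarrow> \<zeta> m x = \<one>\<^bsub>W\<^esub> \<longleftrightarrow> x \<in> M"
    and \<zeta>_pred: "\<And>m a. m \<in> I \<Longrightarrow> a \<in> A \<inter> L \<Longrightarrow> \<zeta> m a = \<zeta> (pred m) (\<phi> a)"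
    and \<zeta>_conj: "\<And>m x g. x \<in> L \<Longrightarrow> g \<in> carrier G \<Longrightarrow>
      \<zeta> m (g \<otimes>\<^bsub>G\<^esub> x \<otimes>\<^bsub>G\<^esub> inv\<^bsub>G\<^esub> g) = \<zeta> m x"
    and deg: "\<And>y. y \<in> carrier P \<Longrightarrow> deg y \<in> I"
    and deg_f: "\<And>g y. g \<in> carrier G \<Longrightarrow> y \<in> carrier P \<Longrightarrow> deg (f g \<otimes>\<^bsub>P\<^esub> y) = deg y"
    and deg_\<tau>: "\<And>y. y \<in> carrier P \<Longrightarrow> deg (inv\<^bsub>P\<^esub> \<tau> \<otimes>\<^bsub>P\<^esub> y) = pred (deg y)"
    and s: "\<And>y. y \<in> carrier P \<Longrightarrow> s y \<in> carrier G"
    and s_eq: "\<And>y g. y \<in> carrier P \<Longrightarrow> g \<in> carrier G \<Longrightarrow>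
      f (s (f g \<otimes>\<^bsub>P\<^esub> y)) \<otimes>\<^bsub>P\<^esub> (f g \<otimes>\<^bsub>P\<^esub> y) = f (s y) \<otimes>\<^bsub>P\<^esub> y"
    and \<alpha>: "\<And>y. y \<in> carrier P \<Longrightarrow> \<alpha> y \<in> A"
    and \<alpha>_eq: "\<And>y a. y \<in> carrier P \<Longrightarrow> a \<in> A \<Longrightarrow>
      f (\<alpha> (f a \<otimes>\<^bsub>P\<^esub> y)) \<otimes>\<^bsub>P\<^esub> (f a \<otimes>\<^bsub>P\<^esub> y) = f (\<alpha> y) \<otimes>\<^bsub>P\<^esub> y"
begin

sublocale f: group_hom G P f
  using f_hom by unfold_locales

text \<open>The effect of \<open>g\<close> from the point \<open>f(g)^-1 y\<close> to the point
  \<open>y\<close>, measured against the section \<open>s\<close>, as for Schreier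
  generators.\<close>

definition transition :: "'a \<Rightarrow> 'p \<Rightarrow> 'a" where
  "transition g y = s y \<otimes>\<^bsub>G\<^esub> g \<otimes>\<^bsub>G\<^esub> inv\<^bsub>G\<^esub> s (inv\<^bsub>P\<^esub> f g \<otimes>\<^bsub>P\<^esub> y)"

definition u :: "'a \<Rightarrow> 'p \<Rightarrow> 'w" where
  "u g y = \<zeta> (deg y) (transition g y)"

definition c :: "'a \<Rightarrow> 'p \<Rightarrow> 'w" where
  "c a y = inv\<^bsub>W\<^esub> u a y \<otimes>\<^bsub>W\<^esub> u (\<phi> a) (inv\<^bsub>P\<^esub> \<tau> \<otimes>\<^bsub>P\<^esub> y)"

definition v :: "'p \<Rightarrow> 'w" where
  "v y = c (\<alpha> y) (f (\<alpha> y) \<otimes>\<^bsub>P\<^esub> y)"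

lemma A_carrier: "a \<in> A \<Longrightarrow> a \<in> carrier G"
  using subgroup.mem_carrier[OF A] .

lemma L_carrier: "x \<in> L \<Longrightarrow> x \<in> carrier G"
  using subgroup.mem_carrier[OF normal_imp_subgroup[OF L]] .

lemma \<phi>_closed: "a \<in> A \<Longrightarrow> \<phi> a \<in> carrier G"
  using \<phi> by (auto simp: hom_def)

lemma \<phi>_mult: "a \<in> A \<Longrightarrow> b \<in> A \<Longrightarrow> \<phi> (a \<otimes>\<^bsub>G\<^esub> b) = \<phi> a \<otimes>\<^bsub>G\<^esub> \<phi> b"
  using \<phi> by (auto simp: hom_def)

lemma \<zeta>_closed: "x \<in> L \<Longrightarrow> \<zeta> m x \<in> carrier W"
  using \<zeta>_hom[of m] by (auto simp: hom_def)

lemma \<zeta>_mult: "x \<in> L \<Longrightarrow> y \<in> L \<Longrightarrow> \<zeta> m (x \<otimes>\<^bsub>G\<^esub> y) = \<zeta> m x \<otimes>\<^bsub>W\<^esub> \<zeta> m y"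
  using \<zeta>_hom[of m] by (auto simp: hom_def)

lemma deg_inv_f: "g \<in> carrier G \<Longrightarrow> y \<in> carrier P \<Longrightarrow> deg (inv\<^bsub>P\<^esub> f g \<otimes>\<^bsub>P\<^esub> y) = deg y"
  using deg_f[of "inv\<^bsub>G\<^esub> g" y] by simp

lemma \<tau>_f_swap:
  assumes "a \<in> A"
  shows "inv\<^bsub>P\<^esub> f (\<phi> a) \<otimes>\<^bsub>P\<^esub> inv\<^bsub>P\<^esub> \<tau> = inv\<^bsub>P\<^esub> \<tau> \<otimes>\<^bsub>P\<^esub> inv\<^bsub>P\<^esub> f a"
  using rel[OF assms] assms \<tau> A_carrier \<phi>_closed f.hom_closed by (metis P.inv_mult_group)

lemma \<phi>_L:
  assumes "a \<in> A \<inter> L"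
  shows "\<phi> a \<in> L"
proof -
  have "f a = \<one>\<^bsub>P\<^esub>"
    using assms ker L_carrier by blast
  then have "\<tau> \<otimes>\<^bsub>P\<^esub> f (\<phi> a) = \<tau>"
    using rel[of a] assms \<tau> by simp
  then have "f (\<phi> a) = \<one>\<^bsub>P\<^esub>"
    using \<tau> \<phi>_closed[of a] assms by simp
  then show ?thesis
    using assms ker \<phi>_closed by blast
qed

text \<open>With \<open>y'\<close> the source point, \<open>f (s y')\<close> and
  \<open>f (s y) f g\<close> carry \<open>y'\<close> to the same representative. Left multiplication
  on \<open>P\<close> is free, so they are equal and the transition lies in the kernel of
  \<open>f\<close>.\<close>

lemma transition_L:
  assumes "g \<in> carrier G" "y \<in> carrier P"
  shows "transition g y \<in> L"
proof -
  define y' where "y' = inv\<^bsub>P\<^esub> f g \<otimes>\<^bsub>P\<^esub> y"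
  have y': "y' \<in> carrier P" "f g \<otimes>\<^bsub>P\<^esub> y' = y"
    using assms by (simp_all add: y'_def flip: P.m_assoc)
  have "f (s y') \<otimes>\<^bsub>P\<^esub> y' = f (s y) \<otimes>\<^bsub>P\<^esub> f g \<otimes>\<^bsub>P\<^esub> y'"
    using s_eq[OF y'(1) assms(1)] y' s assms by (simp add: P.m_assoc)
  then have eq: "f (s y') = f (s y) \<otimes>\<^bsub>P\<^esub> f g"
    using y' s assms by simp
  have "f (transition g y) = \<one>\<^bsub>P\<^esub>"
    using assms y' s eq by (simp add: transition_def flip: y'_def)
  then show ?thesis
    using ker[of "transition g y"] assms s y'(1) by (simp add: transition_def flip: y'_def)
qed

lemma u_closed: "g \<in> carrier G \<Longrightarrow> y \<in> carrier P \<Longrightarrow> u g y \<in> carrier W"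
  by (simp add: u_def \<zeta>_closed transition_L)

text \<open>Transitions compose, as the section at the intermediate point cancels. Both factors use
  the same \<open>\<zeta>\<close> because the degree is constant on \<open>G\<close>-orbits.\<close>

lemma u_mult:
  assumes "g \<in> carrier G" "h \<in> carrier G" "y \<in> carrier P"
  shows "u (g \<otimes>\<^bsub>G\<^esub> h) y = u g y \<otimes>\<^bsub>W\<^esub> u h (inv\<^bsub>P\<^esub> f g \<otimes>\<^bsub>P\<^esub> y)"
proof -
  define y' where "y' = inv\<^bsub>P\<^esub> f g \<otimes>\<^bsub>P\<^esub> y"
  define y'' where "y'' = inv\<^bsub>P\<^esub> f h \<otimes>\<^bsub>P\<^esub> y'"
  have y': "y' \<in> carrier P" and y'': "y'' \<in> carrier P"
    and y''_eq: "inv\<^bsub>P\<^esub> f (g \<otimes>\<^bsub>G\<^esub> h) \<otimes>\<^bsub>P\<^esub> y = y''"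
    using assms by (simp_all add: y'_def y''_def P.inv_mult_group P.m_assoc)
  have "transition (g \<otimes>\<^bsub>G\<^esub> h) y = s y \<otimes>\<^bsub>G\<^esub> (g \<otimes>\<^bsub>G\<^esub> h) \<otimes>\<^bsub>G\<^esub> inv\<^bsub>G\<^esub> s y''"
    using y''_eq by (simp add: transition_def)
  also have "\<dots> = s y \<otimes>\<^bsub>G\<^esub> g \<otimes>\<^bsub>G\<^esub> inv\<^bsub>G\<^esub> s y' \<otimes>\<^bsub>G\<^esub> (s y' \<otimes>\<^bsub>G\<^esub> h \<otimes>\<^bsub>G\<^esub> inv\<^bsub>G\<^esub> s y'')"
    using assms s y' y'' by (simp add: G.m_assoc G.inv_solve_left)
  also have "\<dots> = transition g y \<otimes>\<^bsub>G\<^esub> transition h y'"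
    by (simp add: transition_def y'_def y''_def)
  finally show ?thesis
    unfolding y'_def[symmetric]
    using \<zeta>_mult[OF transition_L[OF assms(1,3)] transition_L[OF assms(2) y']] deg_inv_f[OF assms(1,3)]
    by (simp add: u_def y'_def)
qed

text \<open>Elements of \<open>L\<close> fix every point, so the transition is a conjugate of
  \<open>x\<close>, and \<open>\<zeta>\<close> is invariant under conjugation.\<close>

lemma u_L:
  assumes "x \<in> L" "y \<in> carrier P"
  shows "u x y = \<zeta> (deg y) x"
proof -
  have "f x = \<one>\<^bsub>P\<^esub>"
    using assms ker L_carrier by blast
  then show ?thesis
    using assms \<zeta>_conj s by (simp add: u_def transition_def)
qed

lemma c_closed: "a \<in> A \<Longrightarrow> y \<in> carrier P \<Longrightarrow> c a y \<in> carrier W"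
  by (simp add: c_def u_closed A_carrier \<phi>_closed \<tau>)

text \<open>\<open>c\<close> is the quotient of two crossed homomorphisms into an abelian group:
  \<open>u\<close>, and \<open>u\<close> transported by \<open>\<phi>\<close> and
  \<open>\<tau>\<close>. The relation for \<open>\<tau>\<close> matches the points at which they are
  evaluated.\<close>

lemma c_mult:
  assumes "a \<in> A" "b \<in> A" "y \<in> carrier P"
  shows "c (a \<otimes>\<^bsub>G\<^esub> b) y = c a y \<otimes>\<^bsub>W\<^esub> c b (inv\<^bsub>P\<^esub> f a \<otimes>\<^bsub>P\<^esub> y)"
proof -
  have eq: "inv\<^bsub>P\<^esub> f (\<phi> a) \<otimes>\<^bsub>P\<^esub> (inv\<^bsub>P\<^esub> \<tau> \<otimes>\<^bsub>P\<^esub> y) = inv\<^bsub>P\<^esub> \<tau> \<otimes>\<^bsub>P\<^esub> (inv\<^bsub>P\<^esub> f a \<otimes>\<^bsub>P\<^esub> y)"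
    using \<tau>_f_swap[OF assms(1)] assms \<tau> A_carrier \<phi>_closed by (simp flip: P.m_assoc)
  show ?thesis
    using assms \<tau>
    by (simp add: c_def \<phi>_mult u_mult A_carrier \<phi>_closed u_closed eq W.inv_mult W.m_ac)
qed

text \<open>The two factors are \<open>\<zeta> (deg y) a\<close> inverted and
  \<open>\<zeta> (pred (deg y)) (\<phi> a)\<close>. They cancel by the identification made in the
  gluing.\<close>

lemma c_L:
  assumes "a \<in> A \<inter> L" "y \<in> carrier P"
  shows "c a y = \<one>\<^bsub>W\<^esub>"
  using assms \<tau> \<phi>_L[OF assms(1)] \<zeta>_pred[OF deg[OF assms(2)] assms(1)]
  by (simp add: c_def u_L deg_\<tau> \<zeta>_closed)

lemma v_closed: "y \<in> carrier P \<Longrightarrow> v y \<in> carrier W"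
  by (simp add: v_def c_closed \<alpha> A_carrier)

text \<open>Write \<open>\<alpha> y' = b k a\<close>, where \<open>y'\<close> is the translated
  point, \<open>b = \<alpha> y\<close> and \<open>k\<close> fixes \<open>y\<close>. Expanding
  \<open>c (b k a)\<close> at the orbit representative gives \<open>v y\<close>, then the trivial
  value on \<open>k\<close>, then \<open>c a y\<close>.\<close>

lemma v_translate:
  assumes "a \<in> A" "y \<in> carrier P"
  shows "v (inv\<^bsub>P\<^esub> f a \<otimes>\<^bsub>P\<^esub> y) = v y \<otimes>\<^bsub>W\<^esub> c a y"
proof -
  define y' where "y' = inv\<^bsub>P\<^esub> f a \<otimes>\<^bsub>P\<^esub> y"
  define b where "b = \<alpha> y"
  define b' where "b' = \<alpha> y'"
  \<comment> \<open>Both \<open>b\<close> and \<open>b' a^-1\<close> carry \<open>y\<close> to the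
    representative \<open>z\<close>, so their discrepancy \<open>k\<close> lies in
    \<open>A \<inter> L\<close>.\<close>
  define k where "k = inv\<^bsub>G\<^esub> b \<otimes>\<^bsub>G\<^esub> b' \<otimes>\<^bsub>G\<^esub> inv\<^bsub>G\<^esub> a"
  define z where "z = f b \<otimes>\<^bsub>P\<^esub> y"
  have a: "a \<in> carrier G"
    using assms A_carrier by blast
  have y': "y' \<in> carrier P"
    using assms a by (simp add: y'_def)
  have mem: "b \<in> A" "b' \<in> A" "b \<in> carrier G" "b' \<in> carrier G"
    using assms y' \<alpha> A_carrier by (auto simp: b_def b'_def)
  have k: "k \<in> A" "k \<in> carrier G"
    using mem assms(1) subgroup.m_closed[OF A] subgroup.m_inv_closed[OF A] A_carrier
    by (auto simp: k_def)
  have b': "b' = b \<otimes>\<^bsub>G\<^esub> (k \<otimes>\<^bsub>G\<^esub> a)"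
    using mem a by (simp add: k_def G.m_assoc) (simp flip: G.m_assoc)
  have z': "f b' \<otimes>\<^bsub>P\<^esub> y' = z"
    using \<alpha>_eq[OF assms(2) subgroup.m_inv_closed[OF A assms(1)]] a
    by (simp add: b'_def z_def b_def y'_def)
  have "f b' \<otimes>\<^bsub>P\<^esub> inv\<^bsub>P\<^esub> f a = f b"
    using z' mem a assms(2) by (simp add: z_def y'_def flip: P.m_assoc)
  then have "f k = \<one>\<^bsub>P\<^esub>"
    using mem a by (simp add: k_def P.m_assoc)
  then have kL: "k \<in> A \<inter> L" and fk: "f k = \<one>\<^bsub>P\<^esub>"
    using ker k by auto
  have z: "z \<in> carrier P" and bz: "inv\<^bsub>P\<^esub> f b \<otimes>\<^bsub>P\<^esub> z = y"
    using mem assms(2) by (simp_all add: z_def flip: P.m_assoc)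
  have "v y' = c (b \<otimes>\<^bsub>G\<^esub> (k \<otimes>\<^bsub>G\<^esub> a)) z"
    using z' b' by (simp add: v_def flip: b'_def)
  also have "\<dots> = c b z \<otimes>\<^bsub>W\<^esub> (c k y \<otimes>\<^bsub>W\<^esub> c a y)"
    using c_mult[OF mem(1) subgroup.m_closed[OF A k(1) assms(1)] z] c_mult[OF k(1) assms]
    by (simp add: bz fk assms(2))
  also have "\<dots> = v y \<otimes>\<^bsub>W\<^esub> c a y"
    using c_L[OF kL assms(2)] c_closed[OF assms] by (simp add: v_def z_def flip: b_def)
  finally show ?thesis
    by (simp add: y'_def)
qed

definition lift :: "'a \<Rightarrow> ('p \<Rightarrow> 'w) \<times> 'p" where
  "lift g = (restrict (u g) (carrier P), f g)"

definition lift_stable :: "('p \<Rightarrow> 'w) \<times> 'p" where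
  "lift_stable = (restrict v (carrier P), \<tau>)"

lemma lift_hom: "lift \<in> hom G (wreath W P)"
  unfolding lift_def[abs_def]
  by (rule hom_wreathI) (auto simp: u_closed u_mult)

lemma lift_stable_closed: "lift_stable \<in> carrier (wreath W P)"
  by (simp add: lift_stable_def carrier_wreath v_closed \<tau>)

text \<open>In the second component this is the relation for \<open>\<tau>\<close>; in the first it
  is the coboundary formula \<open>v_translate\<close> with \<open>c\<close> unfolded.\<close>

lemma lift_rel:
  assumes "a \<in> A"
  shows "lift a \<otimes>\<^bsub>wreath W P\<^esub> lift_stable = lift_stable \<otimes>\<^bsub>wreath W P\<^esub> lift (\<phi> a)"
proof -
  have "u a y \<otimes>\<^bsub>W\<^esub> v (inv\<^bsub>P\<^esub> f a \<otimes>\<^bsub>P\<^esub> y) = v y \<otimes>\<^bsub>W\<^esub> u (\<phi> a) (inv\<^bsub>P\<^esub> \<tau> \<otimes>\<^bsub>P\<^esub> y)"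
    if "y \<in> carrier P" for y
  proof -
    have "u a y \<in> carrier W" "u (\<phi> a) (inv\<^bsub>P\<^esub> \<tau> \<otimes>\<^bsub>P\<^esub> y) \<in> carrier W" "v y \<in> carrier W"
      using assms that \<tau> by (simp_all add: u_closed v_closed A_carrier \<phi>_closed)
    then show ?thesis
      using v_translate[OF assms that] 
      by (simp add: c_def W.m_lcomm[of "u a y" "v y"]) (simp flip: W.m_assoc)
  qed
  then show ?thesis
    using assms \<tau> rel
    by (auto simp: lift_def lift_stable_def mult_wreath A_carrier \<phi>_closed intro!: restrict_ext)
qed

text \<open>The kernel lies in \<open>L\<close>, and there the first component is
  \<open>\<zeta> (deg y)\<close> at each \<open>y\<close>, which is trivial exactly on
  \<open>M\<close>.\<close>

lemma lift_ker:
  assumes "g \<in> carrier G"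
  shows "lift g = \<one>\<^bsub>wreath W P\<^esub> \<longleftrightarrow> g \<in> M"
proof
  assume eq: "lift g = \<one>\<^bsub>wreath W P\<^esub>"
  then have "g \<in> L"
    using assms ker by (simp add: lift_def one_wreath)
  moreover have "u g \<one>\<^bsub>P\<^esub> = \<one>\<^bsub>W\<^esub>"
    using eq by (auto simp: lift_def one_wreath dest!: fun_cong[of _ _ "\<one>\<^bsub>P\<^esub>"])
  ultimately show "g \<in> M"
    using u_L[of g "\<one>\<^bsub>P\<^esub>"] \<zeta>_ker[OF deg[of "\<one>\<^bsub>P\<^esub>"]] by simp
next
  assume "g \<in> M"
  then have "g \<in> L"
    using M_subset by blast
  then show "lift g = \<one>\<^bsub>wreath W P\<^esub>"
    using \<open>g \<in> M\<close> ker[OF assms] \<zeta>_ker deg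
    by (auto simp: lift_def one_wreath u_L intro!: restrict_ext)
qed

end

section \<open>Transport to the naturals and ascent along the filtration\<close>

text \<open>A wreath product has a larger type than its factors. Returning to \<open>nat\<close>
  lets the inductions run at a fixed type, the one that \<open>residually_p\<close> asks
  for.\<close>

lemma hnn_realization_nat:
  assumes "hnn_realization p G A \<phi> P f \<tau>" "A \<subseteq> carrier G" "\<phi> ` A \<subseteq> carrier G"
  obtains P' :: "nat monoid" and h where
    "h \<in> iso P P'" "hnn_realization p G A \<phi> P' (h \<circ> f) (h \<tau>)"
proof -
  have "group P" "finite (carrier P)"
    using assms(1) by (auto simp: hnn_realization_def finite_p_group_def)
  then obtain P' :: "nat monoid" and h where "group P'" "h \<in> iso P P'"
    by (rule finite_group_iso_nat)
  then show thesis
    using that[OF _ hnn_realization_iso[OF assms(1) _ _ assms(2,3)]] by simp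
qed

lemma iso_eq_one_iff:
  assumes "h \<in> iso P P'" "group P" "group P'" "x \<in> carrier P"
  shows "h x = \<one>\<^bsub>P'\<^esub> \<longleftrightarrow> x = \<one>\<^bsub>P\<^esub>"
proof -
  have "h \<one>\<^bsub>P\<^esub> = \<one>\<^bsub>P'\<^esub>" "inj_on h (carrier P)"
    using assms hom_one by (auto simp: iso_def bij_betw_def)
  then show ?thesis
    using assms(2,4) inj_on_eq_iff[of h "carrier P" x "\<one>\<^bsub>P\<^esub>"] by (simp add: group.is_monoid)
qed

text \<open>The factor of integers modulo \<open>N\<close> in \<open>Q\<close> supplies the degree:
  \<open>f1\<close> preserves it and the inverse of \<open>\<tau>1\<close> lowers it by one, which
  is the shift of positions in the gluing. The lift to the wreath product then cuts the kernel from
  \<open>L\<close> down to \<open>M\<close>.\<close>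

lemma hnn_realization_refine:
  fixes G :: "'a monoid" and P :: "nat monoid"
  assumes p: "Factorial_Ring.prime p" and G: "finite_p_group p G"
    and A: "subgroup A G" and B: "subgroup B G"
    and iso: "\<phi> \<in> iso (G\<lparr>carrier := A\<rparr>) (G\<lparr>carrier := B\<rparr>)"
    and L: "L \<lhd> G" and M: "M \<lhd> G" and M_subset: "M \<subseteq> L"
    and central: "\<forall>x\<in>L. \<forall>y\<in>carrier G.
      x \<otimes>\<^bsub>G\<^esub> y \<otimes>\<^bsub>G\<^esub> inv\<^bsub>G\<^esub> x \<otimes>\<^bsub>G\<^esub> inv\<^bsub>G\<^esub> y \<in> M"
    and compL: "\<phi> ` (A \<inter> L) = B \<inter> L" and compM: "\<phi> ` (A \<inter> M) = B \<inter> M"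
    and ord: "perm_order (core (quot_dom G A L M) (quot_dom G B L M) (quot_map G A \<phi> L M))
      (quot_map G A \<phi> L M) = p ^ k"
    and real: "hnn_realization p G A \<phi> P f \<tau>"
    and ker: "\<And>g. g \<in> carrier G \<Longrightarrow> f g = \<one>\<^bsub>P\<^esub> \<longleftrightarrow> g \<in> L"
  shows "\<exists>(P' :: nat monoid) f' \<tau>'. hnn_realization p G A \<phi> P' f' \<tau>' \<and>
    (\<forall>g\<in>carrier G. f' g = \<one>\<^bsub>P'\<^esub> \<longleftrightarrow> g \<in> M)"
proof -
  obtain r and W :: "(int \<Rightarrow> 'a set) set monoid" and \<zeta> where
    W: "comm_group W" "finite_p_group p W" and
    \<zeta>: "\<forall>m. \<zeta> m \<in> hom (G\<lparr>carrier := L\<rparr>) W"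
    "\<forall>m\<in>{0..<int (p ^ r)}. \<forall>x\<in>L. \<zeta> m x = \<one>\<^bsub>W\<^esub> \<longleftrightarrow> x \<in> M"
    "\<forall>m\<in>{0..<int (p ^ r)}. \<forall>a\<in>A \<inter> L. \<zeta> m a = \<zeta> ((m - 1) mod int (p ^ r)) (\<phi> a)"
    "\<forall>m. \<forall>x\<in>L. \<forall>g\<in>carrier G. \<zeta> m (g \<otimes>\<^bsub>G\<^esub> x \<otimes>\<^bsub>G\<^esub> inv\<^bsub>G\<^esub> g) = \<zeta> m x"
    by (rule filtration_quotient_gluing[OF p G A B iso L M central compL compM ord])
  define N where "N = p ^ r"
  have N: "0 < N"
    using p by (simp add: N_def prime_gt_0_nat)
  interpret G: group G
    using G by (simp add: finite_p_group_def)
  have P: "finite_p_group p P" and f: "f \<in> hom G P" and \<tau>: "\<tau> \<in> carrier P"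
    and rel: "\<And>a. a \<in> A \<Longrightarrow> f a \<otimes>\<^bsub>P\<^esub> \<tau> = \<tau> \<otimes>\<^bsub>P\<^esub> f (\<phi> a)"
    using real by (auto simp: hnn_realization_def)
  interpret P: group P
    using P by (simp add: finite_p_group_def)
  define C where "C = integer_mod_group N"
  have C_carrier: "carrier C = {0..<int N}"
    using N by (simp add: C_def carrier_integer_mod_group)
  then have C_card: "card (carrier C) = p ^ r"
    by (simp flip: N_def)
  have C_group: "group C"
    by (simp add: C_def)
  have C_mult: "x \<otimes>\<^bsub>C\<^esub> y = (x + y) mod int N" for x y
    by (simp add: C_def)
  define Q where "Q = P \<times>\<times> C"
  define f1 where "f1 g = (f g, 0 :: int)" for g
  \<comment> \<open>The reduction of \<open>1\<close> covers \<open>N = 1\<close>, where the only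
    residue is \<open>0\<close>.\<close>
  define \<tau>1 where "\<tau>1 = (\<tau>, 1 mod int N)"
  interpret Q: group Q
    unfolding Q_def using P.group_axioms C_group by (rule DirProd_group)
  have Q: "finite_p_group p Q"
  proof -
    obtain j where "card (carrier P) = p ^ j"
      using P by (auto simp: finite_p_group_def)
    then have "card (carrier Q) = p ^ (j + r)"
      by (simp add: Q_def C_card card_cartesian_product power_add)
    then show ?thesis
      using P Q.group_axioms by (auto simp: finite_p_group_def Q_def C_carrier)
  qed
  have f1: "f1 \<in> hom G Q"
    using f N by (auto simp: hom_def f1_def Q_def C_carrier C_mult)
  have \<tau>1: "\<tau>1 \<in> carrier Q"
    using \<tau> N by (simp add: \<tau>1_def Q_def C_carrier)
  have inv_\<tau>1: "inv\<^bsub>Q\<^esub> \<tau>1 = (inv\<^bsub>P\<^esub> \<tau>, - 1 mod int N)"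
    using \<tau> N P.group_axioms C_group unfolding \<tau>1_def Q_def
    by (subst inv_DirProd) (simp_all add: C_carrier, simp add: C_def carrier_integer_mod_group mod_minus_eq)
  have AG: "A \<subseteq> carrier G" and \<phi>G: "\<phi> ` A \<subseteq> carrier G"
    using A B iso by (auto simp: iso_def hom_def dest: subgroup.mem_carrier)
  obtain s where s: "\<forall>y\<in>carrier Q. s y \<in> carrier G"
    "\<forall>y\<in>carrier Q. \<forall>h\<in>carrier G.
      f1 (s (f1 h \<otimes>\<^bsub>Q\<^esub> y)) \<otimes>\<^bsub>Q\<^esub> (f1 h \<otimes>\<^bsub>Q\<^esub> y) = f1 (s y) \<otimes>\<^bsub>Q\<^esub> y"
    by (rule orbit_section[OF G.group_axioms Q.group_axioms f1 G.subgroup_self])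
  obtain \<alpha> where \<alpha>: "\<forall>y\<in>carrier Q. \<alpha> y \<in> A"
    "\<forall>y\<in>carrier Q. \<forall>h\<in>A.
      f1 (\<alpha> (f1 h \<otimes>\<^bsub>Q\<^esub> y)) \<otimes>\<^bsub>Q\<^esub> (f1 h \<otimes>\<^bsub>Q\<^esub> y) = f1 (\<alpha> y) \<otimes>\<^bsub>Q\<^esub> y"
    by (rule orbit_section[OF G.group_axioms Q.group_axioms f1 A])
  interpret W: comm_group W by fact
  interpret realization_lift G Q W A L M \<phi> f1 \<tau>1 \<zeta> "{0..<int N}" "\<lambda>m. (m - 1) mod int N" snd s \<alpha>
  proof (intro realization_lift.intro realization_lift_axioms.intro)
    show "\<phi> \<in> hom (G\<lparr>carrier := A\<rparr>) G"
      using iso \<phi>G by (auto simp: iso_def hom_def)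
    show "f1 a \<otimes>\<^bsub>Q\<^esub> \<tau>1 = \<tau>1 \<otimes>\<^bsub>Q\<^esub> f1 (\<phi> a)" if "a \<in> A" for a
      using rel[OF that] by (simp add: f1_def \<tau>1_def Q_def C_mult)
    show "f1 g = \<one>\<^bsub>Q\<^esub> \<longleftrightarrow> g \<in> L" if "g \<in> carrier G" for g
      using ker[OF that] by (simp add: f1_def Q_def C_def)
    show "snd y \<in> {0..<int N}" if "y \<in> carrier Q" for y
      using that by (auto simp: Q_def C_carrier)
    show "snd (f1 g \<otimes>\<^bsub>Q\<^esub> y) = snd y" if "y \<in> carrier Q" for g y
      using that by (auto simp: Q_def C_carrier f1_def C_mult)
    show "snd (inv\<^bsub>Q\<^esub> \<tau>1 \<otimes>\<^bsub>Q\<^esub> y) = (snd y - 1) mod int N" for y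
    proof -
      have "snd (inv\<^bsub>Q\<^esub> \<tau>1 \<otimes>\<^bsub>Q\<^esub> y) = (- 1 mod int N + snd y) mod int N"
        unfolding inv_\<tau>1 by (cases y) (simp add: Q_def C_mult)
      also have "\<dots> = (- 1 + snd y) mod int N"
        by (rule mod_add_left_eq)
      finally show ?thesis
        by simp
    qed
  qed (fact G.group_axioms Q.group_axioms W A L M_subset f1 \<tau>1
      | rule \<zeta>[folded N_def, rule_format] s[rule_format] \<alpha>[rule_format]; assumption)+
  have "hnn_realization p G A \<phi> (wreath W Q) lift lift_stable"
    using finite_p_group_wreath[OF W(2) Q] lift_hom lift_stable_closed lift_rel
    by (simp add: hnn_realization_def)
  then obtain P' :: "nat monoid" and h where h: "h \<in> iso (wreath W Q) P'"
    and real': "hnn_realization p G A \<phi> P' (h \<circ> lift) (h lift_stable)"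
    using AG \<phi>G by (rule hnn_realization_nat)
  have "group P'"
    using real' by (simp add: hnn_realization_def finite_p_group_def)
  then have "(h \<circ> lift) g = \<one>\<^bsub>P'\<^esub> \<longleftrightarrow> g \<in> M" if "g \<in> carrier G" for g
    using iso_eq_one_iff[OF h group_wreath[OF W.is_group Q.is_group]] lift_ker[OF that]
      hom_in_carrier[OF lift_hom that] by simp
  with real' show ?thesis
    by blast
qed

text \<open>Induction along the filtration, from the trivial group with kernel
  \<open>Gs 1 = carrier G\<close> to the trivial kernel \<open>Gs n\<close>, with one refinement for
  each layer.\<close>

lemma exists_faithful_realization:
  fixes G :: "'a monoid"
  assumes p: "Factorial_Ring.prime p" and G: "finite_p_group p G"
    and A: "subgroup A G" and B: "subgroup B G"
    and iso: "\<phi> \<in> iso (G\<lparr>carrier := A\<rparr>) (G\<lparr>carrier := B\<rparr>)"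
    and central: "central_filtration G n Gs" and comp: "compatible G A B \<phi> n Gs"
    and ord: "\<forall>i\<in>{1..n}. \<exists>k. perm_order
            (core (quot_dom G A (Gs i) (Gs (Suc i))) (quot_dom G B (Gs i) (Gs (Suc i)))
                  (quot_map G A \<phi> (Gs i) (Gs (Suc i))))
            (quot_map G A \<phi> (Gs i) (Gs (Suc i))) = p ^ k"
  shows "\<exists>(P :: nat monoid) f \<tau>. hnn_realization p G A \<phi> P f \<tau> \<and> inj_on f (carrier G)"
proof -
  interpret G: group G
    using G by (simp add: finite_p_group_def)
  have fil: "filtration G n Gs"
    using central by (simp add: central_filtration_def)
  then have n: "1 \<le> n"
    by (simp add: filtration_def)
  have "\<exists>(P :: nat monoid) f \<tau>. hnn_realization p G A \<phi> P f \<tau> \<and>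
      (\<forall>g\<in>carrier G. f g = \<one>\<^bsub>P\<^esub> \<longleftrightarrow> g \<in> Gs i)" if "1 \<le> i" "i \<le> n" for i
    using that
  proof (induction i rule: dec_induct)
    case base
    define P :: "nat monoid" where "P = \<lparr>carrier = {0}, monoid.mult = (\<lambda>x y. 0), one = 0\<rparr>"
    have "group P"
      by (rule groupI) (auto simp: P_def)
    moreover have "card (carrier P) = p ^ 0"
      by (simp add: P_def)
    ultimately have "finite_p_group p P"
      unfolding finite_p_group_def by (metis P_def finite.emptyI finite.insertI partial_object.select_convs(1))
    then have "hnn_realization p G A \<phi> P (\<lambda>_. 0) 0"
      by (simp add: hnn_realization_def hom_def P_def)
    moreover have "\<forall>g\<in>carrier G. (0::nat) = \<one>\<^bsub>P\<^esub> \<longleftrightarrow> g \<in> Gs 1"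
      using fil by (simp add: filtration_def P_def)
    ultimately show ?case
      by fastforce
  next
    case (step i)
    then have i: "i \<in> {1..<n}" "i \<in> {1..n}" "Suc i \<in> {1..n}"
      by auto
    obtain P :: "nat monoid" and f \<tau> where real: "hnn_realization p G A \<phi> P f \<tau>"
      and ker: "\<And>g. g \<in> carrier G \<Longrightarrow> f g = \<one>\<^bsub>P\<^esub> \<longleftrightarrow> g \<in> Gs i"
      using step by auto
    obtain k where "perm_order
            (core (quot_dom G A (Gs i) (Gs (Suc i))) (quot_dom G B (Gs i) (Gs (Suc i)))
                  (quot_map G A \<phi> (Gs i) (Gs (Suc i))))
            (quot_map G A \<phi> (Gs i) (Gs (Suc i))) = p ^ k"
      using ord i by blast
    moreover have "Gs i \<lhd> G" "Gs (Suc i) \<lhd> G" "Gs (Suc i) \<subseteq> Gs i"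
      using fil i unfolding filtration_def by blast+
    moreover have "\<forall>x\<in>Gs i. \<forall>y\<in>carrier G.
        x \<otimes>\<^bsub>G\<^esub> y \<otimes>\<^bsub>G\<^esub> inv\<^bsub>G\<^esub> x \<otimes>\<^bsub>G\<^esub> inv\<^bsub>G\<^esub> y \<in> Gs (Suc i)"
      using central i unfolding central_filtration_def by blast
    moreover have "\<phi> ` (A \<inter> Gs i) = B \<inter> Gs i" "\<phi> ` (A \<inter> Gs (Suc i)) = B \<inter> Gs (Suc i)"
      using comp i unfolding compatible_def by blast+
    ultimately show ?case
      by (intro hnn_realization_refine[OF p G A B iso _ _ _ _ _ _ _ real ker])
  qed
  from this[OF n order.refl] obtain P :: "nat monoid" and f \<tau>
    where real: "hnn_realization p G A \<phi> P f \<tau>" and ker: "\<forall>g\<in>carrier G. f g = \<one>\<^bsub>P\<^esub> \<longleftrightarrow> g \<in> Gs n"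
    by blast
  have "group_hom G P f"
    using real G.group_axioms
    by (simp add: hnn_realization_def finite_p_group_def group_hom_def group_hom_axioms_def)
  moreover have "Gs n = {\<one>\<^bsub>G\<^esub>}"
    using fil by (simp add: filtration_def)
  ultimately have "inj_on f (carrier G)"
    using ker group_hom.inj_on_one_iff by blast
  then show ?thesis
    using real by blast
qed

section \<open>Separating reduced words\<close>

definition stable_pow :: "('p, 'q) monoid_scheme \<Rightarrow> 'p \<Rightarrow> bool \<Rightarrow> 'p" where
  "stable_pow P \<tau> e = (if e then \<tau> else inv\<^bsub>P\<^esub> \<tau>)"

text \<open>\<open>(True, g)\<close> stands for \<open>t g\<close> and \<open>(False, g)\<close> for \<open>t\<^sup>-\<^sup>1 g\<close>.\<close>
fun syl_eval :: "('p, 'q) monoid_scheme \<Rightarrow> ('a \<Rightarrow> 'p) \<Rightarrow> 'p \<Rightarrow> (bool \<times> 'a) list \<Rightarrow> 'p" where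
  "syl_eval P f \<tau> [] = \<one>\<^bsub>P\<^esub>"
| "syl_eval P f \<tau> ((e, g) # ps) = stable_pow P \<tau> e \<otimes>\<^bsub>P\<^esub> f g \<otimes>\<^bsub>P\<^esub> syl_eval P f \<tau> ps"

text \<open>Excludes the pinches \<open>t b t^-1\<close> with \<open>b\<close> in \<open>B\<close>
  and \<open>t^-1 a t\<close> with \<open>a\<close> in \<open>A\<close>. The group element of the
  last syllable is unrestricted.\<close>

fun reduced :: "'a set \<Rightarrow> 'a set \<Rightarrow> (bool \<times> 'a) list \<Rightarrow> bool" where
  "reduced A B ((e, g) # (e', g') # ps) \<longleftrightarrow>
    (e \<noteq> e' \<longrightarrow> g \<notin> (if e then B else A)) \<and> reduced A B ((e', g') # ps)"
| "reduced A B ps \<longleftrightarrow> True"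

lemma reduced_append: "reduced A B (xs @ ys) \<Longrightarrow> reduced A B xs \<and> reduced A B ys"
proof (induction A B xs rule: reduced.induct)
  case ("2_2" A B x)
  then show ?case
    by (cases x; cases ys) auto
qed auto

lemma reduced_Cons: "reduced A B (x # xs) \<Longrightarrow> reduced A B xs"
  using reduced_append[of A B "[x]" xs] by simp

text \<open>A value in \<open>f(G)\<close> means that the path traced in the coset graph closes up.
  Avoiding all of \<open>f(G)\<close>, and not just the identity, also takes care of a leading
  letter from \<open>G\<close>.\<close>

definition separates :: "('a, 'b) monoid_scheme \<Rightarrow> 'a set \<Rightarrow> 'a set \<Rightarrow> ('p, 'q) monoid_scheme \<Rightarrow>
    ('a \<Rightarrow> 'p) \<Rightarrow> 'p \<Rightarrow> nat \<Rightarrow> bool" where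
  "separates G A B P f \<tau> n \<longleftrightarrow> (\<forall>ps. set ps \<subseteq> UNIV \<times> carrier G \<longrightarrow> reduced A B ps \<longrightarrow>
    ps \<noteq> [] \<longrightarrow> length ps \<le> n \<longrightarrow> syl_eval P f \<tau> ps \<notin> f ` carrier G)"

lemma separatesD:
  assumes "separates G A B P f \<tau> n" "set ps \<subseteq> UNIV \<times> carrier G" "reduced A B ps" "ps \<noteq> []"
    "length ps \<le> n" "g \<in> carrier G"
  shows "syl_eval P f \<tau> ps \<noteq> f g"
  using assms unfolding separates_def by blast

lemma stable_pow_closed: "group P \<Longrightarrow> \<tau> \<in> carrier P \<Longrightarrow> stable_pow P \<tau> e \<in> carrier P"
  by (simp add: stable_pow_def)

lemma syl_eval_closed:
  assumes "group P" "f \<in> hom G P" "\<tau> \<in> carrier P" "set ps \<subseteq> UNIV \<times> carrier G"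
  shows "syl_eval P f \<tau> ps \<in> carrier P"
proof -
  interpret group P by fact
  show ?thesis
    using assms(4) by (induction ps) (auto simp: stable_pow_closed assms hom_in_carrier[OF assms(2)])
qed

lemma syl_eval_iso:
  assumes "group P" "group P'" "f \<in> hom G P" "\<tau> \<in> carrier P" "h \<in> iso P P'"
    and "set ps \<subseteq> UNIV \<times> carrier G"
  shows "syl_eval P' (h \<circ> f) (h \<tau>) ps = h (syl_eval P f \<tau> ps)"
proof -
  have h: "h \<in> hom P P'"
    using assms(5) by (simp add: iso_def)
  interpret h: group_hom P P' h
    using assms(1,2) h by (simp add: group_hom_def group_hom_axioms_def)
  have "stable_pow P' (h \<tau>) e = h (stable_pow P \<tau> e)" for e
    using assms(4) by (simp add: stable_pow_def)
  then show ?thesis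
    using assms(6)
    by (induction ps) (auto simp: stable_pow_closed assms hom_in_carrier[OF assms(3)] syl_eval_closed[OF assms(1,3,4)])
qed

text \<open>In the graph with vertices \<open>P/f(G)\<close> and edges \<open>P/f(A)\<close>, a reduced syllable list traces a reduced path.
  The first component in the wreath product counts, modulo \<open>p\<close>, the signed passages through each edge. A closed
  path of length \<open>n + 1\<close> with all counts zero passes twice through its first edge, and so contains a shorter
  closed path.\<close>
locale girth_step =
  G: group G + P: group P
  for G :: "('a, 'b) monoid_scheme" and P :: "('p, 'q) monoid_scheme" +
  fixes A B :: "'a set" and \<phi> :: "'a \<Rightarrow> 'a" and f :: "'a \<Rightarrow> 'p" and \<tau> :: 'p and p n :: nat
  assumes f_hom: "f \<in> hom G P" and inj: "inj_on f (carrier G)" and \<tau>: "\<tau> \<in> carrier P"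
    and A: "subgroup A G" and \<phi>: "\<And>a. a \<in> A \<Longrightarrow> \<phi> a \<in> B" and B: "B \<subseteq> carrier G"
    and rel: "\<And>a. a \<in> A \<Longrightarrow> f a \<otimes>\<^bsub>P\<^esub> \<tau> = \<tau> \<otimes>\<^bsub>P\<^esub> f (\<phi> a)"
    and p: "2 \<le> p"
    and sep: "separates G A B P f \<tau> n"
begin

sublocale f: group_hom G P f
  using f_hom by unfold_locales

definition Q where "Q = wreath (integer_mod_group p) P"

definition v :: "'p \<Rightarrow> int" where "v y = (if y \<in> f ` A then 1 else 0)"

definition f' where "f' g = (\<lambda>y\<in>carrier P. 0 :: int, f g)"

definition \<tau>' where "\<tau>' = (restrict v (carrier P), \<tau>)"

text \<open>The edge, as a left coset of \<open>f(A)\<close>, that a stable letter traverses when it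
  starts at the identity of \<open>P\<close>. The inverse letter traverses the edge of its endpoint
  backwards.\<close>

definition edge :: "bool \<Rightarrow> 'p set" where
  "edge e = (if e then f ` A else (\<lambda>a. inv\<^bsub>P\<^esub> \<tau> \<otimes>\<^bsub>P\<^esub> f a) ` A)"

definition weight :: "bool \<Rightarrow> 'p \<Rightarrow> int" where
  "weight e y = (if y \<in> edge e then if e then 1 else - 1 mod int p else 0)"

lemma A_carrier: "a \<in> A \<Longrightarrow> a \<in> carrier G"
  using subgroup.mem_carrier[OF A] .

lemma carrier_Z: "carrier (integer_mod_group p) = {0..<int p}"
  using p by (simp add: carrier_integer_mod_group)

lemma carrier_Q: "carrier Q = (carrier P \<rightarrow>\<^sub>E {0..<int p}) \<times> carrier P"
  by (simp add: Q_def carrier_wreath carrier_Z)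

lemma group_Q: "group Q"
  unfolding Q_def by (rule group_wreath) auto

lemma mult_Q: "(u, x) \<otimes>\<^bsub>Q\<^esub> (w, y) =
    ((\<lambda>z\<in>carrier P. (u z + w (inv\<^bsub>P\<^esub> x \<otimes>\<^bsub>P\<^esub> z)) mod int p), x \<otimes>\<^bsub>P\<^esub> y)"
  by (simp add: Q_def mult_wreath)

lemma f'_hom: "f' \<in> hom G Q"
  unfolding f'_def[abs_def] Q_def
  by (rule hom_wreathI[of _ _ _ _ "\<lambda>_ _. 0"]) (use f_hom p in \<open>auto simp: carrier_Z\<close>)

lemma \<tau>'_closed: "\<tau>' \<in> carrier Q"
  using p \<tau> by (auto simp: \<tau>'_def carrier_Q v_def)

lemma f_A_translate:
  assumes "a \<in> A" "y \<in> carrier P"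
  shows "inv\<^bsub>P\<^esub> f a \<otimes>\<^bsub>P\<^esub> y \<in> f ` A \<longleftrightarrow> y \<in> f ` A"
proof
  have a: "a \<in> carrier G" "inv\<^bsub>G\<^esub> a \<in> A"
    using assms(1) A_carrier subgroup.m_inv_closed[OF A] by auto
  assume "inv\<^bsub>P\<^esub> f a \<otimes>\<^bsub>P\<^esub> y \<in> f ` A"
  then obtain b where b: "b \<in> A" "inv\<^bsub>P\<^esub> f a \<otimes>\<^bsub>P\<^esub> y = f b"
    by auto
  then have "y = f (a \<otimes>\<^bsub>G\<^esub> b)"
    using assms a A_carrier by (simp flip: P.inv_solve_left)
  then show "y \<in> f ` A"
    using b(1) assms(1) subgroup.m_closed[OF A] by blast
next
  have a: "a \<in> carrier G" "inv\<^bsub>G\<^esub> a \<in> A"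
    using assms(1) A_carrier subgroup.m_inv_closed[OF A] by auto
  assume "y \<in> f ` A"
  then obtain b where b: "b \<in> A" "y = f b"
    by auto
  then have "inv\<^bsub>P\<^esub> f a \<otimes>\<^bsub>P\<^esub> y = f (inv\<^bsub>G\<^esub> a \<otimes>\<^bsub>G\<^esub> b)"
    using a A_carrier by simp
  then show "inv\<^bsub>P\<^esub> f a \<otimes>\<^bsub>P\<^esub> y \<in> f ` A"
    using b(1) a(2) subgroup.m_closed[OF A] by blast
qed

text \<open>As \<open>f'\<close> has zero first component, the relation there only says that
  \<open>v\<close> is invariant under left multiplication by \<open>f a\<close>, which holds for the
  indicator of \<open>f(A)\<close>.\<close>

lemma rel':
  assumes "a \<in> A"
  shows "f' a \<otimes>\<^bsub>Q\<^esub> \<tau>' = \<tau>' \<otimes>\<^bsub>Q\<^esub> f' (\<phi> a)"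
  using assms rel \<tau> p
  by (auto simp: f'_def \<tau>'_def Q_def mult_wreath v_def f_A_translate A_carrier intro!: restrict_ext)

lemma f'_inj: "inj_on f' (carrier G)"
  using inj by (auto simp: inj_on_def f'_def)

lemma \<tau>_edge:
  assumes "y \<in> carrier P"
  shows "\<tau> \<otimes>\<^bsub>P\<^esub> y \<in> f ` A \<longleftrightarrow> y \<in> edge False"
proof -
  have "\<tau> \<otimes>\<^bsub>P\<^esub> y = f a \<longleftrightarrow> y = inv\<^bsub>P\<^esub> \<tau> \<otimes>\<^bsub>P\<^esub> f a" if "a \<in> A" for a
    using assms \<tau> A_carrier[OF that] P.inv_solve_left[of y \<tau> "f a"] by auto
  then show ?thesis
    by (auto simp: edge_def)
qed

lemma stable_pow': "stable_pow Q \<tau>' e = (restrict (weight e) (carrier P), stable_pow P \<tau> e)"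
proof (cases e)
  case True
  then show ?thesis
    by (auto simp: stable_pow_def \<tau>'_def weight_def v_def edge_def)
next
  case False
  have "restrict v (carrier P) \<in> carrier P \<rightarrow>\<^sub>E carrier (integer_mod_group p)"
    using p by (auto simp: v_def carrier_Z)
  then have "inv\<^bsub>Q\<^esub> \<tau>' = ((\<lambda>z\<in>carrier P. inv\<^bsub>integer_mod_group p\<^esub> v (\<tau> \<otimes>\<^bsub>P\<^esub> z)), inv\<^bsub>P\<^esub> \<tau>)"
    using \<tau> unfolding Q_def \<tau>'_def by (subst inv_wreath) (auto simp: P.is_group intro!: restrict_ext)
  moreover have "inv\<^bsub>integer_mod_group p\<^esub> v (\<tau> \<otimes>\<^bsub>P\<^esub> z) = weight False z" if "z \<in> carrier P" for z
    using that p by (subst inv_integer_mod_group) (auto simp: v_def weight_def \<tau>_edge carrier_Z)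
  ultimately show ?thesis
    using False by (auto simp: stable_pow_def intro!: restrict_ext)
qed

lemma snd_syl_eval: "snd (syl_eval Q f' \<tau>' ps) = syl_eval P f \<tau> ps"
proof (induction ps)
  case Nil
  then show ?case
    by (simp add: Q_def one_wreath)
next
  case (Cons x ps)
  obtain e g where x: "x = (e, g)"
    by fastforce
  obtain w z where wz: "syl_eval Q f' \<tau>' ps = (w, z)"
    by fastforce
  then show ?case
    using Cons x by (simp add: stable_pow' f'_def[of g] mult_Q)
qed

lemma fst_syl_eval:
  assumes "g \<in> carrier G" "y \<in> carrier P" "set ps \<subseteq> UNIV \<times> carrier G"
  shows "fst (syl_eval Q f' \<tau>' ((e, g) # ps)) y =
    (weight e y + fst (syl_eval Q f' \<tau>' ps) (inv\<^bsub>P\<^esub> (stable_pow P \<tau> e \<otimes>\<^bsub>P\<^esub> f g) \<otimes>\<^bsub>P\<^esub> y)) mod int p"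
proof -
  obtain w z where wz: "syl_eval Q f' \<tau>' ps = (w, z)"
    by fastforce
  show ?thesis
    using assms \<tau>
    by (simp add: stable_pow' f'_def[of g] wz mult_Q stable_pow_closed mod_add_left_eq)
qed

text \<open>The first component at \<open>y\<close> adds up, modulo \<open>p\<close>, the weights of
  the syllables at \<open>y\<close> moved back by the preceding prefix. If it is nonzero, some
  syllable traverses the edge of \<open>y\<close>.\<close>

lemma nonzero_edge:
  assumes "set ps \<subseteq> UNIV \<times> carrier G" "y \<in> carrier P" "fst (syl_eval Q f' \<tau>' ps) y \<noteq> 0"
  shows "\<exists>xs e g ys. ps = xs @ (e, g) # ys \<and> inv\<^bsub>P\<^esub> syl_eval P f \<tau> xs \<otimes>\<^bsub>P\<^esub> y \<in> edge e"
  using assms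
proof (induction ps arbitrary: y)
  case Nil
  then show ?case
    by (simp add: Q_def one_wreath)
next
  case (Cons x ps)
  obtain e g where x: "x = (e, g)"
    by fastforce
  have g: "g \<in> carrier G" and ps: "set ps \<subseteq> UNIV \<times> carrier G"
    using Cons.prems(1) x by auto
  show ?case
  proof (cases "y \<in> edge e")
    case True
    then have "inv\<^bsub>P\<^esub> syl_eval P f \<tau> [] \<otimes>\<^bsub>P\<^esub> y \<in> edge e"
      using Cons.prems(2) by simp
    then show ?thesis
      using x by blast
  next
    case False
    define t where "t = stable_pow P \<tau> e \<otimes>\<^bsub>P\<^esub> f g"
    have t: "t \<in> carrier P"
      using g \<tau> by (simp add: t_def stable_pow_closed)
    have "fst (syl_eval Q f' \<tau>' (x # ps)) y = fst (syl_eval Q f' \<tau>' ps) (inv\<^bsub>P\<^esub> t \<otimes>\<^bsub>P\<^esub> y) mod int p"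
      using fst_syl_eval[OF g Cons.prems(2) ps, of e] False by (simp add: x weight_def flip: t_def)
    then have "fst (syl_eval Q f' \<tau>' ps) (inv\<^bsub>P\<^esub> t \<otimes>\<^bsub>P\<^esub> y) \<noteq> 0"
      using Cons.prems(3) by auto
    then obtain xs e' g' ys where xs: "ps = xs @ (e', g') # ys"
      and mem: "inv\<^bsub>P\<^esub> syl_eval P f \<tau> xs \<otimes>\<^bsub>P\<^esub> (inv\<^bsub>P\<^esub> t \<otimes>\<^bsub>P\<^esub> y) \<in> edge e'"
      using Cons.IH[OF ps, of "inv\<^bsub>P\<^esub> t \<otimes>\<^bsub>P\<^esub> y"] t Cons.prems(2) by auto
    have "syl_eval P f \<tau> xs \<in> carrier P"
      using ps xs by (intro syl_eval_closed[OF P.is_group f_hom \<tau>]) auto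
    then have "inv\<^bsub>P\<^esub> syl_eval P f \<tau> (x # xs) \<otimes>\<^bsub>P\<^esub> y \<in> edge e'"
      using mem t Cons.prems(2) by (simp add: x P.inv_mult_group P.m_assoc flip: t_def)
    moreover have "x # ps = (x # xs) @ (e', g') # ys"
      by (simp add: xs)
    ultimately show ?thesis
      by blast
  qed
qed

text \<open>A second passage through the first edge in the same direction makes
  \<open>(e, g) # xs\<close> a closed path. In the opposite direction \<open>xs\<close> itself
  closes up, or is empty and leaves a pinch. As \<open>length xs < n\<close>, separation or
  reducedness is violated.\<close>

lemma edge_collision:
  assumes g: "g \<in> carrier G" and xs: "set xs \<subseteq> UNIV \<times> carrier G"
    and len: "length xs < n"
    and red: "reduced A B ((e, g) # xs)" and red': "xs = [] \<Longrightarrow> e \<noteq> e' \<Longrightarrow> g \<notin> (if e then B else A)"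
    and mem: "inv\<^bsub>P\<^esub> syl_eval P f \<tau> xs \<otimes>\<^bsub>P\<^esub> (inv\<^bsub>P\<^esub> (stable_pow P \<tau> e \<otimes>\<^bsub>P\<^esub> f g) \<otimes>\<^bsub>P\<^esub>
      (if e then \<one>\<^bsub>P\<^esub> else inv\<^bsub>P\<^esub> \<tau>)) \<in> edge e'"
  shows False
proof -
  define x where "x = syl_eval P f \<tau> xs"
  have x: "x \<in> carrier P"
    unfolding x_def by (rule syl_eval_closed[OF P.is_group f_hom \<tau> xs])
  have fg: "f g \<in> carrier P"
    using g by simp
  have no_closed: "syl_eval P f \<tau> ((e, g) # xs) \<noteq> f k" if "k \<in> carrier G" for k
    using separatesD[OF sep _ red _ _ that] g xs len by auto
  \<comment> \<open>The case of opposite directions: for non-empty \<open>xs\<close> its value lies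
    in \<open>f(G)\<close>; for empty \<open>xs\<close> injectivity of \<open>f\<close> puts
    \<open>g\<close> itself into \<open>A\<close> or \<open>B\<close>.\<close>
  have no_backtrack: False if k: "k \<in> carrier G" and "k \<in> (if e then B else A)" "e \<noteq> e'"
    and eq: "f g \<otimes>\<^bsub>P\<^esub> x = f k" for k
  proof (cases "xs = []")
    case True
    then have "f g = f k"
      using eq fg by (simp add: x_def)
    then have "g = k"
      using inj g k by (meson inj_onD)
    then show False
      using red' that True by auto
  next
    case False
    have "x = f (inv\<^bsub>G\<^esub> g \<otimes>\<^bsub>G\<^esub> k)"
      using eq g k x P.inv_solve_left[of x "f g" "f k"] by simp
    then show False
      using separatesD[OF sep xs reduced_Cons[OF red] False _ G.m_closed[OF G.inv_closed[OF g] k]] len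
      by (simp add: x_def)
  qed
  obtain a where a: "a \<in> A" and a_eq: "inv\<^bsub>P\<^esub> x \<otimes>\<^bsub>P\<^esub> (inv\<^bsub>P\<^esub> (stable_pow P \<tau> e \<otimes>\<^bsub>P\<^esub> f g) \<otimes>\<^bsub>P\<^esub>
      (if e then \<one>\<^bsub>P\<^esub> else inv\<^bsub>P\<^esub> \<tau>)) = (if e' then \<one>\<^bsub>P\<^esub> else inv\<^bsub>P\<^esub> \<tau>) \<otimes>\<^bsub>P\<^esub> f a"
    using mem A_carrier by (auto simp: edge_def x_def split: if_splits)
  define b where "b = inv\<^bsub>G\<^esub> a"
  have b: "b \<in> A" "b \<in> carrier G" "\<phi> b \<in> B" "\<phi> b \<in> carrier G" "f b = inv\<^bsub>P\<^esub> f a"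
    using a subgroup.m_inv_closed[OF A] A_carrier \<phi> B by (auto simp: b_def)
  have fa: "f a \<in> carrier P" "f b \<in> carrier P" "f (\<phi> b) \<in> carrier P"
    using a b A_carrier by auto
  have rel_b: "f b \<otimes>\<^bsub>P\<^esub> \<tau> = \<tau> \<otimes>\<^bsub>P\<^esub> f (\<phi> b)"
    by (rule rel[OF b(1)])
  have "inv\<^bsub>P\<^esub> (inv\<^bsub>P\<^esub> x \<otimes>\<^bsub>P\<^esub> (inv\<^bsub>P\<^esub> (stable_pow P \<tau> e \<otimes>\<^bsub>P\<^esub> f g) \<otimes>\<^bsub>P\<^esub>
      (if e then \<one>\<^bsub>P\<^esub> else inv\<^bsub>P\<^esub> \<tau>))) = inv\<^bsub>P\<^esub> ((if e' then \<one>\<^bsub>P\<^esub> else inv\<^bsub>P\<^esub> \<tau>) \<otimes>\<^bsub>P\<^esub> f a)"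
    by (simp only: a_eq)
  \<comment> \<open>The membership inverted, so that it becomes an equation between the traversed
    path and an element of \<open>A\<close>, up to one \<open>\<tau>\<close> on either side.\<close>
  then have key: "(if e then \<tau> else \<one>\<^bsub>P\<^esub>) \<otimes>\<^bsub>P\<^esub> (f g \<otimes>\<^bsub>P\<^esub> x) = f b \<otimes>\<^bsub>P\<^esub> (if e' then \<one>\<^bsub>P\<^esub> else \<tau>)"
    using x fg fa \<tau> by (cases e; cases e') (auto simp: stable_pow_def P.inv_mult_group P.m_assoc b(5) P.inv_solve_left)
  show False
  proof (cases e; cases e')
    assume "e" "e'"
    then have "syl_eval P f \<tau> ((e, g) # xs) = f b"
      using key x fg fa \<tau> by (simp add: stable_pow_def P.m_assoc flip: x_def)
    then show False
      using no_closed b by blast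
  next
    assume "e" "\<not> e'"
    then have "\<tau> \<otimes>\<^bsub>P\<^esub> (f g \<otimes>\<^bsub>P\<^esub> x) = \<tau> \<otimes>\<^bsub>P\<^esub> f (\<phi> b)"
      using key rel_b by simp
    then have "f g \<otimes>\<^bsub>P\<^esub> x = f (\<phi> b)"
      using x fg fa \<tau> by simp
    then show False
      using no_backtrack[of "\<phi> b"] b \<open>e\<close> \<open>\<not> e'\<close> by simp
  next
    assume "\<not> e" "e'"
    then have "f g \<otimes>\<^bsub>P\<^esub> x = f b"
      using key x fg fa by simp
    then show False
      using no_backtrack[of b] b \<open>\<not> e\<close> \<open>e'\<close> by simp
  next
    assume "\<not> e" "\<not> e'"
    then have "f g \<otimes>\<^bsub>P\<^esub> x = \<tau> \<otimes>\<^bsub>P\<^esub> f (\<phi> b)"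
      using key rel_b x fg by simp
    then have "syl_eval P f \<tau> ((e, g) # xs) = f (\<phi> b)"
      using \<open>\<not> e\<close> x fg fa \<tau> by (simp add: stable_pow_def P.m_assoc flip: x_def) (simp flip: P.m_assoc)
    then show False
      using no_closed b by blast
  qed
qed

text \<open>A value in \<open>f'(G)\<close> has zero first component everywhere. At a point of the
  first edge the first syllable contributes \<open>1\<close> or \<open>-1\<close>, so a later
  syllable must pass through the same edge, which \<open>edge_collision\<close> forbids.\<close>

lemma separates_Suc: "separates G A B Q f' \<tau>' (Suc n)"
  unfolding separates_def
proof (intro allI impI notI)
  fix ps assume ps: "set ps \<subseteq> UNIV \<times> carrier G" "reduced A B ps" "ps \<noteq> []" "length ps \<le> Suc n"
    and "syl_eval Q f' \<tau>' ps \<in> f' ` carrier G"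
  then obtain k where k: "k \<in> carrier G" and eq: "syl_eval Q f' \<tau>' ps = f' k"
    by blast
  have "syl_eval P f \<tau> ps = f k"
    using snd_syl_eval[of ps] by (simp add: eq f'_def)
  \<comment> \<open>Shorter lists are already separated in \<open>P\<close>.\<close>
  then have len: "length ps = Suc n"
    using separatesD[OF sep ps(1,2,3) _ k] ps(4) by (meson le_SucE)
  obtain e g r where r: "ps = (e, g) # r"
    using ps(3) by (metis list.exhaust surj_pair)
  \<comment> \<open>A point of the first edge, given by the identity element of
    \<open>A\<close>.\<close>
  define y where "y = (if e then \<one>\<^bsub>P\<^esub> else inv\<^bsub>P\<^esub> \<tau>)"
  have y: "y \<in> carrier P"
    using \<tau> by (simp add: y_def)
  have g: "g \<in> carrier G" and r_car: "set r \<subseteq> UNIV \<times> carrier G"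
    using ps(1) r by auto
  have "y \<in> edge e"
    using \<tau> subgroup.one_closed[OF A] imageI[of "\<one>\<^bsub>G\<^esub>" A f]
      imageI[of "\<one>\<^bsub>G\<^esub>" A "\<lambda>a. inv\<^bsub>P\<^esub> \<tau> \<otimes>\<^bsub>P\<^esub> f a"]
    by (simp add: y_def edge_def)
  \<comment> \<open>Here \<open>2 \<le> p\<close> enters: neither \<open>1\<close> nor
    \<open>-1\<close> vanishes modulo \<open>p\<close>.\<close>
  then have w: "weight e y mod int p \<noteq> 0"
    using p by (simp add: weight_def zmod_zminus1_eq_if)
  define y' where "y' = inv\<^bsub>P\<^esub> (stable_pow P \<tau> e \<otimes>\<^bsub>P\<^esub> f g) \<otimes>\<^bsub>P\<^esub> y"
  have y': "y' \<in> carrier P"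
    using y g \<tau> by (simp add: y'_def stable_pow_closed)
  have "(weight e y + fst (syl_eval Q f' \<tau>' r) y') mod int p = 0"
    using fst_syl_eval[OF g y r_car, of e] eq y by (simp add: r f'_def flip: y'_def)
  then have "fst (syl_eval Q f' \<tau>' r) y' \<noteq> 0"
    using w by auto
  from nonzero_edge[OF r_car y' this] obtain xs e' g' ys
    where xs: "r = xs @ (e', g') # ys" and mem: "inv\<^bsub>P\<^esub> syl_eval P f \<tau> xs \<otimes>\<^bsub>P\<^esub> y' \<in> edge e'"
    by blast
  show False
  proof (rule edge_collision[OF g])
    show "set xs \<subseteq> UNIV \<times> carrier G" "length xs < n"
      using r_car len by (auto simp: xs r)
    show "reduced A B ((e, g) # xs)"
      using reduced_append[of A B "(e, g) # xs"] ps(2) by (simp add: r xs)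
    show "g \<notin> (if e then B else A)" if "xs = []" "e \<noteq> e'"
      using ps(2) that by (simp add: r xs)
  qed (use mem in \<open>simp add: y'_def y_def\<close>)
qed

end

text \<open>Iteration of the wreath step with the integers modulo \<open>p\<close>. The start is
  vacuous, as no non-empty list has length \<open>0\<close>.\<close>

lemma exists_separating_realization:
  fixes G :: "'a monoid"
  assumes p: "Factorial_Ring.prime p" and G: "group G"
    and A: "subgroup A G" and B: "subgroup B G" and \<phi>: "\<phi> ` A \<subseteq> B"
    and base: "\<exists>(P :: nat monoid) f \<tau>. hnn_realization p G A \<phi> P f \<tau> \<and> inj_on f (carrier G)"
  shows "\<exists>(P :: nat monoid) f \<tau>. hnn_realization p G A \<phi> P f \<tau> \<and> inj_on f (carrier G) \<and>
    separates G A B P f \<tau> n"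
proof (induction n)
  case 0
  then show ?case
    using base by (simp add: separates_def)
next
  case (Suc n)
  then obtain P :: "nat monoid" and f \<tau> where real: "hnn_realization p G A \<phi> P f \<tau>"
    and inj: "inj_on f (carrier G)" and sep: "separates G A B P f \<tau> n"
    by blast
  have P: "group P" "finite_p_group p P"
    using real by (auto simp: hnn_realization_def finite_p_group_def)
  have Bc: "B \<subseteq> carrier G" and Ac: "A \<subseteq> carrier G"
    using A B subgroup.subset by auto
  interpret girth_step G P A B \<phi> f \<tau> p n
    using G P(1) real inj A \<phi> Bc p sep
    by (auto simp: girth_step_def girth_step_axioms_def hnn_realization_def prime_ge_2_nat)
  have "finite_p_group p (integer_mod_group p)"
    using carrier_Z by (auto simp: finite_p_group_def intro!: exI[of _ 1])
  then have fin: "finite_p_group p Q"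
    unfolding Q_def using P(2) by (rule finite_p_group_wreath)
  then have "hnn_realization p G A \<phi> Q f' \<tau>'"
    using f'_hom \<tau>'_closed rel' by (simp add: hnn_realization_def)
  moreover have "\<phi> ` A \<subseteq> carrier G"
    using \<phi> Bc by blast
  ultimately obtain P' :: "nat monoid" and h where h: "h \<in> iso Q P'"
    and real': "hnn_realization p G A \<phi> P' (h \<circ> f') (h \<tau>')"
    by (rule hnn_realization_nat[OF _ Ac])
  have P': "group P'"
    using real' by (auto simp: hnn_realization_def finite_p_group_def)
  have h_inj: "inj_on h (carrier Q)"
    using h by (simp add: iso_def bij_betw_def)
  have f'_closed: "f' g \<in> carrier Q" if "g \<in> carrier G" for g
    using f'_hom that by (rule hom_in_carrier)
  have "inj_on (h \<circ> f') (carrier G)"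
    using f'_inj f'_closed by (intro comp_inj_on inj_on_subset[OF h_inj]) auto
  moreover have "separates G A B P' (h \<circ> f') (h \<tau>') (Suc n)"
    unfolding separates_def
  proof (intro allI impI notI)
    fix ps assume ps: "set ps \<subseteq> UNIV \<times> carrier G" "reduced A B ps" "ps \<noteq> []" "length ps \<le> Suc n"
      and "syl_eval P' (h \<circ> f') (h \<tau>') ps \<in> (h \<circ> f') ` carrier G"
    then obtain k where k: "k \<in> carrier G" "h (syl_eval Q f' \<tau>' ps) = h (f' k)"
      using syl_eval_iso[OF group_Q P' f'_hom \<tau>'_closed h ps(1)] by auto
    then have "syl_eval Q f' \<tau>' ps = f' k"
      using h_inj f'_closed syl_eval_closed[OF group_Q f'_hom \<tau>'_closed ps(1)] by (meson inj_onD)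
    then show False
      using separatesD[OF separates_Suc ps k(1)] by blast
  qed
  ultimately show ?case
    using real' by blast
qed

section \<open>The HNN extension\<close>

fun hnn_eval :: "('p, 'q) monoid_scheme \<Rightarrow> ('a \<Rightarrow> 'p) \<Rightarrow> 'p \<Rightarrow> 'a hnn_word \<Rightarrow> 'p" where
  "hnn_eval P f \<tau> [] = \<one>\<^bsub>P\<^esub>"
| "hnn_eval P f \<tau> (Inl g # w) = f g \<otimes>\<^bsub>P\<^esub> hnn_eval P f \<tau> w"
| "hnn_eval P f \<tau> (Inr e # w) = stable_pow P \<tau> e \<otimes>\<^bsub>P\<^esub> hnn_eval P f \<tau> w"

lemma hnn_valid_simps [simp]:
  "hnn_valid G []"
  "hnn_valid G (Inl g # w) \<longleftrightarrow> g \<in> carrier G \<and> hnn_valid G w"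
  "hnn_valid G (Inr e # w) \<longleftrightarrow> hnn_valid G w"
  "hnn_valid G (u @ w) \<longleftrightarrow> hnn_valid G u \<and> hnn_valid G w"
  by (auto simp: hnn_valid_def)

lemma hnn_eq_valid:
  assumes "hnn_eq G A \<phi> u w" "group G" "A \<subseteq> carrier G" "\<phi> ` A \<subseteq> carrier G"
  shows "hnn_valid G u \<and> hnn_valid G w"
proof -
  interpret group G by fact
  show ?thesis
    using assms(1) by induction (use assms(3,4) in auto)
qed

lemma hnn_eval_closed:
  assumes "group P" "f \<in> hom G P" "\<tau> \<in> carrier P" "hnn_valid G w"
  shows "hnn_eval P f \<tau> w \<in> carrier P"
proof -
  interpret group P by fact
  show ?thesis
    using assms(4)
  proof (induction w)
    case (Cons l w)
    then show ?case
      by (cases l) (auto simp: stable_pow_closed assms(1,3) hom_in_carrier[OF assms(2)])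
  qed simp
qed

lemma hnn_eval_append:
  assumes "group P" "f \<in> hom G P" "\<tau> \<in> carrier P" "hnn_valid G u" "hnn_valid G w"
  shows "hnn_eval P f \<tau> (u @ w) = hnn_eval P f \<tau> u \<otimes>\<^bsub>P\<^esub> hnn_eval P f \<tau> w"
proof -
  interpret group P by fact
  show ?thesis
    using assms(4)
  proof (induction u)
    case Nil
    then show ?case
      using hnn_eval_closed[OF assms(1,2,3,5)] by simp
  next
    case (Cons l u)
    then show ?case
      using hnn_eval_closed[OF assms(1,2,3)] assms(5) stable_pow_closed[OF assms(1,3)]
        hom_in_carrier[OF assms(2)]
      by (cases l) (auto simp: m_assoc)
  qed
qed

lemma hnn_eq_eval:
  assumes "hnn_eq G A \<phi> u w" "hnn_realization p G A \<phi> P f \<tau>" "group G" "A \<subseteq> carrier G" "\<phi> ` A \<subseteq> carrier G"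
  shows "hnn_eval P f \<tau> u = hnn_eval P f \<tau> w"
proof -
  have P: "group P" and f: "f \<in> hom G P" and \<tau>: "\<tau> \<in> carrier P"
    and rel: "\<And>a. a \<in> A \<Longrightarrow> f a \<otimes>\<^bsub>P\<^esub> \<tau> = \<tau> \<otimes>\<^bsub>P\<^esub> f (\<phi> a)"
    using assms(2) by (auto simp: hnn_realization_def finite_p_group_def)
  interpret P: group P by fact
  interpret f: group_hom G P f
    using assms(3) P f by (simp add: group_hom_def group_hom_axioms_def)
  show ?thesis
    using assms(1)
  proof induction
    case (cong u v x y)
    then show ?case
      using hnn_eq_valid[OF cong.hyps(1) assms(3-5)] by (simp add: hnn_eval_append[OF P f \<tau>])
  next
    case (conj a)
    then have "a \<in> carrier G" "\<phi> a \<in> carrier G"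
      using assms(4,5) by auto
    then show ?case
      using \<tau> rel[OF conj] by (simp add: stable_pow_def) (simp flip: P.m_assoc)
  qed (auto simp: \<tau> stable_pow_def P.m_assoc)
qed

definition hnn_hom :: "('p, 'q) monoid_scheme \<Rightarrow> ('a \<Rightarrow> 'p) \<Rightarrow> 'p \<Rightarrow> 'a hnn_word set \<Rightarrow> 'p" where
  "hnn_hom P f \<tau> U = hnn_eval P f \<tau> (SOME w. w \<in> U)"

text \<open>Formulated for an arbitrary set of words: the product in \<open>HNN\<close> is given as
  a set of words, and this form evaluates it without first showing that it is a class.\<close>

lemma hnn_hom_eq:
  assumes "w \<in> U" "\<And>u. u \<in> U \<Longrightarrow> hnn_eval P f \<tau> u = x"
  shows "hnn_hom P f \<tau> U = x"
  unfolding hnn_hom_def using assms by (metis someI)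

lemma hnn_hom_class:
  assumes "hnn_realization p G A \<phi> P f \<tau>" "group G" "A \<subseteq> carrier G" "\<phi> ` A \<subseteq> carrier G" "hnn_valid G w"
  shows "hnn_hom P f \<tau> (hnn_class G A \<phi> w) = hnn_eval P f \<tau> w"
proof (rule hnn_hom_eq)
  show "w \<in> hnn_class G A \<phi> w"
    using assms(5) by (simp add: hnn_class_def hnn_eq.refl)
  show "hnn_eval P f \<tau> u = hnn_eval P f \<tau> w" if "u \<in> hnn_class G A \<phi> w" for u
    using hnn_eq_eval[OF _ assms(1-4), of w u] that by (simp add: hnn_class_def)
qed

lemma hnn_hom_hom:
  assumes "hnn_realization p G A \<phi> P f \<tau>" "group G" "A \<subseteq> carrier G" "\<phi> ` A \<subseteq> carrier G"
  shows "hnn_hom P f \<tau> \<in> hom (HNN G A \<phi>) P"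
proof (rule homI)
  have P: "group P" "f \<in> hom G P" "\<tau> \<in> carrier P"
    using assms(1) by (auto simp: hnn_realization_def finite_p_group_def)
  fix U assume "U \<in> carrier (HNN G A \<phi>)"
  then obtain u where u: "hnn_valid G u" "U = hnn_class G A \<phi> u"
    by (auto simp: HNN_def)
  then show "hnn_hom P f \<tau> U \<in> carrier P"
    using hnn_hom_class[OF assms] hnn_eval_closed[OF P] by simp
  fix V assume "V \<in> carrier (HNN G A \<phi>)"
  then obtain w where w: "hnn_valid G w" "V = hnn_class G A \<phi> w"
    by (auto simp: HNN_def)
  have "hnn_hom P f \<tau> (U \<otimes>\<^bsub>HNN G A \<phi>\<^esub> V) = hnn_eval P f \<tau> u \<otimes>\<^bsub>P\<^esub> hnn_eval P f \<tau> w"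
  proof (rule hnn_hom_eq)
    show "u @ w \<in> U \<otimes>\<^bsub>HNN G A \<phi>\<^esub> V"
    proof -
      have "u \<in> U" "w \<in> V" "hnn_eq G A \<phi> (u @ w) (u @ w)"
        using u w by (auto simp: hnn_class_def intro: hnn_eq.refl)
      then show ?thesis
        by (auto simp: HNN_def)
    qed
    fix z assume "z \<in> U \<otimes>\<^bsub>HNN G A \<phi>\<^esub> V"
    then obtain x y where xy: "hnn_eq G A \<phi> u x" "hnn_eq G A \<phi> w y" "hnn_eq G A \<phi> (x @ y) z"
      using u w by (auto simp: HNN_def hnn_class_def)
    then have "hnn_eval P f \<tau> z = hnn_eval P f \<tau> (x @ y)"
      using hnn_eq_eval[OF _ assms] by metis
    also have "\<dots> = hnn_eval P f \<tau> x \<otimes>\<^bsub>P\<^esub> hnn_eval P f \<tau> y"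
      using hnn_eq_valid[OF xy(1) assms(2-4)] hnn_eq_valid[OF xy(2) assms(2-4)]
      by (intro hnn_eval_append[OF P]) auto
    finally show "hnn_eval P f \<tau> z = hnn_eval P f \<tau> u \<otimes>\<^bsub>P\<^esub> hnn_eval P f \<tau> w"
      using hnn_eq_eval[OF xy(1) assms] hnn_eq_eval[OF xy(2) assms] by simp
  qed
  then show "hnn_hom P f \<tau> (U \<otimes>\<^bsub>HNN G A \<phi>\<^esub> V) = hnn_hom P f \<tau> U \<otimes>\<^bsub>P\<^esub> hnn_hom P f \<tau> V"
    using u w hnn_hom_class[OF assms] by simp
qed

section \<open>Reduced forms and the conclusion\<close>

fun syl_word :: "(bool \<times> 'a) list \<Rightarrow> 'a hnn_word" where
  "syl_word [] = []"
| "syl_word ((e, g) # ps) = Inr e # Inl g # syl_word ps"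

lemma hnn_valid_syl_word: "hnn_valid G (syl_word ps) \<longleftrightarrow> set ps \<subseteq> UNIV \<times> carrier G"
  by (induction ps rule: syl_word.induct) auto

lemma hnn_eval_syl_word:
  assumes "group P" "f \<in> hom G P" "\<tau> \<in> carrier P" "set ps \<subseteq> UNIV \<times> carrier G"
  shows "hnn_eval P f \<tau> (syl_word ps) = syl_eval P f \<tau> ps"
proof -
  interpret group P by fact
  show ?thesis
    using assms(4)
    by (induction ps rule: syl_word.induct)
      (auto simp: m_assoc stable_pow_closed[OF assms(1,3)] syl_eval_closed[OF assms(1-3)]
        hom_in_carrier[OF assms(2)])
qed

declare hnn_eq.trans [trans]

lemma pinch_False:
  assumes "a \<in> A" "g \<in> carrier G" "\<phi> a \<in> carrier G" "hnn_valid G w"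
  shows "hnn_eq G A \<phi> (Inr False # Inl a # Inr True # Inl g # w) (Inl (\<phi> a \<otimes>\<^bsub>G\<^esub> g) # w)"
proof -
  have "hnn_eq G A \<phi> (Inr False # Inl a # Inr True # Inl g # w) (Inl (\<phi> a) # Inl g # w)"
    using hnn_eq.cong[OF hnn_eq.conj[OF assms(1)], of G "[]" "Inl g # w" \<phi>] assms by simp
  also have "hnn_eq G A \<phi> \<dots> (Inl (\<phi> a \<otimes>\<^bsub>G\<^esub> g) # w)"
    using hnn_eq.cong[OF hnn_eq.mult[OF assms(3,2)], of "[]" w A \<phi>] assms by simp
  finally show ?thesis .
qed

text \<open>Replace \<open>\<phi> a\<close> by \<open>t^-1 a t\<close>; the two pairs
  \<open>t t^-1\<close> cancel and \<open>a\<close> merges with \<open>g\<close>.\<close>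

lemma pinch_True:
  assumes "a \<in> A" "A \<subseteq> carrier G" "g \<in> carrier G" "\<phi> a \<in> carrier G" "hnn_valid G w"
  shows "hnn_eq G A \<phi> (Inr True # Inl (\<phi> a) # Inr False # Inl g # w) (Inl (a \<otimes>\<^bsub>G\<^esub> g) # w)"
proof -
  have a: "a \<in> carrier G"
    using assms(1,2) by blast
  have "hnn_eq G A \<phi> (Inr True # Inl (\<phi> a) # Inr False # Inl g # w)
      (Inr True # Inr False # Inl a # Inr True # Inr False # Inl g # w)"
    using hnn_eq.cong[OF hnn_eq.sym[OF hnn_eq.conj[OF assms(1)]], of G "[Inr True]" "Inr False # Inl g # w" \<phi>] assms
    by simp
  also have "hnn_eq G A \<phi> \<dots> (Inl a # Inr True # Inr False # Inl g # w)"
    using hnn_eq.cong[OF hnn_eq.t_tinv, of G "[]" "Inl a # Inr True # Inr False # Inl g # w" A \<phi>] assms a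
    by simp
  also have "hnn_eq G A \<phi> \<dots> (Inl a # Inl g # w)"
    using hnn_eq.cong[OF hnn_eq.t_tinv, of G "[Inl a]" "Inl g # w" A \<phi>] assms a
    by simp
  also have "hnn_eq G A \<phi> \<dots> (Inl (a \<otimes>\<^bsub>G\<^esub> g) # w)"
    using hnn_eq.cong[OF hnn_eq.mult[OF a assms(3)], of "[]" w A \<phi>] assms
    by simp
  finally show ?thesis .
qed

text \<open>Letters are added on the left. A letter of \<open>G\<close> merges with the leading one;
  a stable letter starts a new syllable, unless that creates a pinch, which then removes the first
  syllable instead.\<close>

lemma hnn_reduced_form:
  assumes "group G" "A \<subseteq> carrier G" "\<phi> ` A = B" "B \<subseteq> carrier G" "hnn_valid G w"
  shows "\<exists>g ps. g \<in> carrier G \<and> set ps \<subseteq> UNIV \<times> carrier G \<and> reduced A B ps \<and>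
    hnn_eq G A \<phi> w (Inl g # syl_word ps)"
  using assms(5)
proof (induction w)
  case Nil
  interpret group G by fact
  have "hnn_eq G A \<phi> [] [Inl \<one>\<^bsub>G\<^esub>]"
    by (rule hnn_eq.sym[OF hnn_eq.one])
  then show ?case
    by (intro exI[of _ "\<one>\<^bsub>G\<^esub>"] exI[of _ "[]"]) simp
next
  case (Cons l w)
  interpret group G by fact
  from Cons obtain g ps where g: "g \<in> carrier G" and ps: "set ps \<subseteq> UNIV \<times> carrier G" "reduced A B ps"
    and eq: "hnn_eq G A \<phi> w (Inl g # syl_word ps)"
    by (cases l) auto
  have valid: "hnn_valid G (syl_word ps)"
    using ps(1) by (simp add: hnn_valid_syl_word)
  have eq': "hnn_eq G A \<phi> (l # w) (l # Inl g # syl_word ps)"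
    using hnn_eq.cong[OF eq, of "[l]" "[]"] Cons.prems by (cases l) auto
  show ?case
  proof (cases l)
    case (Inl h)
    then have h: "h \<in> carrier G"
      using Cons.prems by simp
    have "hnn_eq G A \<phi> (l # Inl g # syl_word ps) (Inl (h \<otimes>\<^bsub>G\<^esub> g) # syl_word ps)"
      using hnn_eq.cong[OF hnn_eq.mult[OF h g], of "[]" "syl_word ps" A \<phi>] valid by (simp add: Inl)
    then have "hnn_eq G A \<phi> (l # w) (Inl (h \<otimes>\<^bsub>G\<^esub> g) # syl_word ps)"
      by (rule hnn_eq.trans[OF eq'])
    then show ?thesis
      using h g ps by blast
  next
    case (Inr e)
    show ?thesis
    proof (cases "reduced A B ((e, g) # ps)")
      case True
      have "hnn_eq G A \<phi> (l # Inl g # syl_word ps) (Inl \<one>\<^bsub>G\<^esub> # syl_word ((e, g) # ps))"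
        using hnn_eq.cong[OF hnn_eq.sym[OF hnn_eq.one], of G "[]" "syl_word ((e, g) # ps)" A \<phi>] g valid
        by (simp add: Inr)
      then have "hnn_eq G A \<phi> (l # w) (Inl \<one>\<^bsub>G\<^esub> # syl_word ((e, g) # ps))"
        by (rule hnn_eq.trans[OF eq'])
      moreover have "set ((e, g) # ps) \<subseteq> UNIV \<times> carrier G"
        using g ps(1) by simp
      ultimately show ?thesis
        using True one_closed by blast
    next
      case False
      \<comment> \<open>As \<open>ps\<close> is reduced, only the junction with the new syllable can
        fail.\<close>
      then obtain e' g' qs where qs: "ps = (e', g') # qs" "e \<noteq> e'" "g \<in> (if e then B else A)"
        using ps(2) by (cases ps) (auto split: if_splits)
      have g': "g' \<in> carrier G" and qs_car: "set qs \<subseteq> UNIV \<times> carrier G"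
        using ps(1) qs(1) by auto
      then have vqs: "hnn_valid G (syl_word qs)"
        by (simp add: hnn_valid_syl_word)
      have "\<exists>k\<in>carrier G. hnn_eq G A \<phi> (l # Inl g # syl_word ps) (Inl k # syl_word qs)"
      proof (cases e)
        case True
        then obtain a where a: "a \<in> A" "g = \<phi> a"
          using qs(3) assms(3) by auto
        then show ?thesis
          using pinch_True[OF a(1) assms(2) g' _ vqs, of \<phi>] g True qs g' assms(2) Inr
          by (intro bexI[of _ "a \<otimes>\<^bsub>G\<^esub> g'"]) auto
      next
        case e: False
        then have g: "g \<in> A" "\<phi> g \<in> carrier G"
          using qs(3) assms(3,4) by auto
        then show ?thesis
          using pinch_False[where \<phi> = \<phi>, OF g(1) g' g(2) vqs] e qs g' Inr
          by (intro bexI[of _ "\<phi> g \<otimes>\<^bsub>G\<^esub> g'"]) auto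
      qed
      then obtain k where k: "k \<in> carrier G" "hnn_eq G A \<phi> (l # w) (Inl k # syl_word qs)"
        using hnn_eq.trans[OF eq'] by blast
      moreover have "reduced A B qs"
        using ps(2) qs(1) reduced_Cons by blast
      ultimately show ?thesis
        using qs_car by blast
    qed
  qed
qed

theorem theorem1p5:
  fixes G :: "'a monoid" and p :: nat and A B :: "'a set" and \<phi> :: "'a \<Rightarrow> 'a"
    and n :: nat and Gs :: "nat \<Rightarrow> 'a set"
  assumes "Factorial_Ring.prime p"
    and "group G" and "finite (carrier G)" and "\<exists>k. card (carrier G) = p ^ k"
    and "subgroup A G" and "subgroup B G"
    and "\<phi> \<in> iso (G\<lparr>carrier := A\<rparr>) (G\<lparr>carrier := B\<rparr>)"
    and "central_filtration G n Gs"
    and "compatible G A B \<phi> n Gs"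
    and "\<forall>i\<in>{1..n}. \<exists>k. perm_order
            (core (quot_dom G A (Gs i) (Gs (Suc i))) (quot_dom G B (Gs i) (Gs (Suc i)))
                  (quot_map G A \<phi> (Gs i) (Gs (Suc i))))
            (quot_map G A \<phi> (Gs i) (Gs (Suc i))) = p ^ k"
  shows "residually_p p (HNN G A \<phi>)"
  unfolding residually_p_def
proof (intro ballI impI)
  have fin: "finite_p_group p G"
    using assms(2-4) by (simp add: finite_p_group_def)
  have Ac: "A \<subseteq> carrier G" and Bc: "B \<subseteq> carrier G"
    using assms(5,6) subgroup.subset by auto
  have img: "\<phi> ` A = B"
    using assms(7) by (simp add: iso_def bij_betw_def)
  then have \<phi>c: "\<phi> ` A \<subseteq> carrier G" and \<phi>B: "\<phi> ` A \<subseteq> B"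
    using Bc by auto
  fix U assume "U \<in> carrier (HNN G A \<phi>)" and nontrivial: "U \<noteq> \<one>\<^bsub>HNN G A \<phi>\<^esub>"
  then obtain w where w: "hnn_valid G w" "U = hnn_class G A \<phi> w"
    by (auto simp: HNN_def)
  obtain g ps where g: "g \<in> carrier G" and ps: "set ps \<subseteq> UNIV \<times> carrier G" "reduced A B ps"
    and eq: "hnn_eq G A \<phi> w (Inl g # syl_word ps)"
    using hnn_reduced_form[OF assms(2) Ac img Bc w(1)] by blast
  \<comment> \<open>The separation bound is chosen after the reduced form is known: it is the number
    of its syllables.\<close>
  obtain P :: "nat monoid" and f \<tau> where real: "hnn_realization p G A \<phi> P f \<tau>"
    and inj: "inj_on f (carrier G)" and sep: "separates G A B P f \<tau> (length ps)"
    using exists_separating_realization[OF assms(1,2,5,6) \<phi>B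
        exists_faithful_realization[OF assms(1) fin assms(5-10)]] by blast
  have P: "group P" "finite (carrier P)" "\<exists>k. card (carrier P) = p ^ k"
    and f: "f \<in> hom G P" and \<tau>: "\<tau> \<in> carrier P"
    using real by (auto simp: hnn_realization_def finite_p_group_def)
  interpret P: group P by fact
  interpret f: group_hom G P f
    using assms(2) P f by (simp add: group_hom_def group_hom_axioms_def)
  have "hnn_hom P f \<tau> U = hnn_eval P f \<tau> (Inl g # syl_word ps)"
    using hnn_hom_class[OF real assms(2) Ac \<phi>c w(1)] hnn_eq_eval[OF eq real assms(2) Ac \<phi>c] w(2) by simp
  also have "\<dots> = f g \<otimes>\<^bsub>P\<^esub> syl_eval P f \<tau> ps"
    by (simp add: hnn_eval_syl_word[OF P(1) f \<tau> ps(1)])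
  also have "\<dots> \<noteq> \<one>\<^bsub>P\<^esub>"
  \<comment> \<open>Without stable letters, faithfulness of \<open>f\<close> suffices. Otherwise
    triviality would put the value of \<open>ps\<close> into \<open>f(G)\<close>, against
    separation.\<close>
  proof (cases "ps = []")
    case True
    have "g \<noteq> \<one>\<^bsub>G\<^esub>"
    proof
      assume "g = \<one>\<^bsub>G\<^esub>"
      then have "hnn_eq G A \<phi> w []"
        using eq True hnn_eq.trans[OF _ hnn_eq.one] by simp
      then have "hnn_class G A \<phi> w = hnn_class G A \<phi> []"
        unfolding hnn_class_def by (blast intro: hnn_eq.trans hnn_eq.sym)
      then show False
        using nontrivial w(2) by (simp add: HNN_def)
    qed
    then have "f g \<noteq> \<one>\<^bsub>P\<^esub>"
      using inj g inj_onD[OF inj, of g "\<one>\<^bsub>G\<^esub>"] by auto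
    then show ?thesis
      using True g by simp
  next
    case False
    show ?thesis
    proof
      assume "f g \<otimes>\<^bsub>P\<^esub> syl_eval P f \<tau> ps = \<one>\<^bsub>P\<^esub>"
      then have "syl_eval P f \<tau> ps = f (inv\<^bsub>G\<^esub> g)"
        using g syl_eval_closed[OF P(1) f \<tau> ps(1)] P.inv_solve_left[of "syl_eval P f \<tau> ps" "f g" "\<one>\<^bsub>P\<^esub>"]
        by simp
      then show False
        using separatesD[OF sep ps False order.refl f.G.inv_closed[OF g]] by blast
    qed
  qed
  finally show "\<exists>(P :: nat monoid) h. group P \<and> finite (carrier P) \<and> (\<exists>k. card (carrier P) = p ^ k)
      \<and> h \<in> hom (HNN G A \<phi>) P \<and> h U \<noteq> \<one>\<^bsub>P\<^esub>"
    using P hnn_hom_hom[OF real assms(2) Ac \<phi>c] by blast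
qed

end
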